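(* Let $2\le k\le n$, let $\Omega\subset\mathbb R^n$ be a bounded smooth uniformly convex domain, let $E\in\mathrm{Gr}(k-1,n)$ be fixed, $V=E^\perp$, and let $f\in C^\infty(\overline\Omega)$ satisfy $f\ge c_0>0$. For $t>0$ let $u_{t,E}^f\in C^\infty(\overline\Omega)$ be the unique smooth $k$-admissible solution of $\sigma_k(D^2u_{t,E}^f)=f$ in $\Omega$, $u_{t,E}^f=t\phi_E$ on $\partial\Omega$, where $\phi_E(x)=\frac12|P_Ex|^2$. Let $K$ be a compact subset of $\Gamma_E=\{x\in\partial\Omega:|P_V\nu(x)|>0\}$. Then, as $t\to\infty$, $$\partial_\nu u_{t,E}^f=t\,\partial_\nu\phi_E+t^{1-k}\,\partial_\nu w_E^f+O\big(t^{1-k-k/2}\big)$$ uniformly on $K$.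
   Context: For a symmetric matrix $M$, $\sigma_j(M)$ is the $j$-th elementary symmetric function of its eigenvalues; $\Gamma_k=\{\lambda\in\mathbb R^n:\sigma_j(\lambda)>0,\ 1\le j\le k\}$; a $C^2$ function $u$ is $k$-admissible if the eigenvalues of $D^2u(x)$ lie in $\Gamma_k$ for all $x\in\Omega$. Existence and uniqueness of $u_{t,E}^f$ is due to Caffarelli–Nirenberg–Spruck. Uniformly convex means that all principal curvatures of $\partial\Omega$ are bounded below by a positive constant. $\mathrm{Gr}(m,n)$ is the Grassmannian of $m$-dimensional linear subspaces; $P_E,P_V$ are orthogonal projections; $\nu$ is the outward unit normal to $\partial\Omega$. The fiberwise Poisson correction $w_E^f$ is defined on each section $\Omega\cap(y+V)$, $y\in P_E(\Omega)$, as the solution of $\Delta_Vw_E^f=f$ in $\Omega\cap(y+V)$, $w_E^f=0$ on the boundary of this section in $y+V$, where $\Delta_Vu=\mathrm{tr}(P_VD^2u)$ is the Laplacian in the $V$ directions; these solutions together form a function $w_E^f\in C^\infty(\overline\Omega)$ with $\Delta_Vw_E^f=f$ in $\Omega$ and $w_E^f=0$ on $\partial\Omega$. *)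

theory Defs
  imports "HOL-Analysis.Analysis"
begin

definition partial_deriv :: "'n::finite \<Rightarrow> (real^'n \<Rightarrow> real) \<Rightarrow> real^'n \<Rightarrow> real" where
  "partial_deriv i u x = frechet_derivative u (at x) (axis i 1)"

fun iter_partial :: "'n::finite list \<Rightarrow> (real^'n \<Rightarrow> real) \<Rightarrow> real^'n \<Rightarrow> real" where
  "iter_partial [] u = u"
| "iter_partial (i # is) u = partial_deriv i (iter_partial is u)"

definition grad :: "(real^'n::finite \<Rightarrow> real) \<Rightarrow> real^'n \<Rightarrow> real^'n" where
  "grad u x = (\<chi> i. partial_deriv i u x)"

definition hessian :: "(real^'n::finite \<Rightarrow> real) \<Rightarrow> real^'n \<Rightarrow> real^'n^'n" where
  "hessian u x = (\<chi> i j. partial_deriv i (partial_deriv j u) x)"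

text \<open>Used for open \<^term>\<open>S\<close> only, where \<^term>\<open>(differentiable_on)\<close> is differentiability at
  every point in the full sense.\<close>

definition smooth_on :: "(real^'n::finite) set \<Rightarrow> (real^'n \<Rightarrow> real) \<Rightarrow> bool" where
  "smooth_on S u \<longleftrightarrow> (\<forall>is. iter_partial is u differentiable_on S)"

text \<open>The space of functions smooth up to the boundary: all derivatives exist in the open set
  \<^term>\<open>\<Omega>\<close> and extend continuously to its closure, the extension of the function itself being
  given by its own boundary values.\<close>

definition smooth_upto_closure :: "(real^'n::finite) set \<Rightarrow> (real^'n \<Rightarrow> real) \<Rightarrow> bool" where
  "smooth_upto_closure \<Omega> u \<longleftrightarrow>
     smooth_on \<Omega> u \<and> continuous_on (closure \<Omega>) u \<and>
     (\<forall>is. \<exists>g. continuous_on (closure \<Omega>) g \<and> (\<forall>x\<in>\<Omega>. g x = iter_partial is u x))"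

definition elem_sym :: "nat \<Rightarrow> real^'n::finite \<Rightarrow> real" where
  "elem_sym j \<mu> = (\<Sum>S\<in>{S. S \<subseteq> (UNIV :: 'n set) \<and> card S = j}. \<Prod>i\<in>S. \<mu> $ i)"

definition Gamma_cone :: "nat \<Rightarrow> (real^'n::finite) set" where
  "Gamma_cone k = {\<mu>. \<forall>j\<in>{1..k}. elem_sym j \<mu> > 0}"

text \<open>The eigenvalues, repeated according to their multiplicity as roots of the characteristic
  polynomial, in some order. They exist for every symmetric real matrix, and the order is
  irrelevant below since \<^const>\<open>elem_sym\<close> is symmetric.\<close>

definition eigenvalues :: "real^'n^'n::finite \<Rightarrow> real^'n" where
  "eigenvalues A = (SOME \<mu>. \<forall>s. det (mat s - A) = (\<Prod>i\<in>UNIV. s - \<mu> $ i))"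

definition sigma :: "nat \<Rightarrow> real^'n^'n::finite \<Rightarrow> real" where
  "sigma j A = elem_sym j (eigenvalues A)"

definition admissible :: "nat \<Rightarrow> (real^'n::finite) set \<Rightarrow> (real^'n \<Rightarrow> real) \<Rightarrow> bool" where
  "admissible k \<Omega> u \<longleftrightarrow> (\<forall>x\<in>\<Omega>. eigenvalues (hessian u x) \<in> Gamma_cone k)"

definition local_defining_function ::
  "(real^'n::finite) set \<Rightarrow> real^'n \<Rightarrow> (real^'n) set \<Rightarrow> (real^'n \<Rightarrow> real) \<Rightarrow> bool" where
  "local_defining_function \<Omega> p U \<rho> \<longleftrightarrow>
     open U \<and> p \<in> U \<and> smooth_on U \<rho> \<and> (\<forall>x\<in>U. grad \<rho> x \<noteq> 0) \<and> \<Omega> \<inter> U = {x\<in>U. \<rho> x < 0}"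

definition smooth_domain :: "(real^'n::finite) set \<Rightarrow> bool" where
  "smooth_domain \<Omega> \<longleftrightarrow>
     open \<Omega> \<and> connected \<Omega> \<and> \<Omega> \<noteq> {} \<and>
     (\<forall>p\<in>frontier \<Omega>. \<exists>U \<rho>. local_defining_function \<Omega> p U \<rho>)"

text \<open>The value at a boundary point does not depend on the local defining function.\<close>

definition outward_normal :: "(real^'n::finite) set \<Rightarrow> real^'n \<Rightarrow> real^'n" where
  "outward_normal \<Omega> p =
     (THE \<nu>. \<exists>U \<rho>. local_defining_function \<Omega> p U \<rho> \<and> \<nu> = grad \<rho> p /\<^sub>R norm (grad \<rho> p))"

text \<open>Principal curvatures are the eigenvalues of the Weingarten map, the derivative of the
  Gauss map along the boundary, acting on tangent vectors. The sign is such that the unit sphere,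
  as the boundary of the ball, has curvatures 1. A derivative \<^term>\<open>D\<close> within the boundary is
  not unique, but its restriction to the tangent space is.\<close>

definition principal_curvature :: "(real^'n::finite) set \<Rightarrow> real^'n \<Rightarrow> real \<Rightarrow> bool" where
  "principal_curvature \<Omega> p \<kappa> \<longleftrightarrow>
     (\<exists>D \<tau>. (outward_normal \<Omega> has_derivative D) (at p within frontier \<Omega>) \<and>
            \<tau> \<noteq> 0 \<and> \<tau> \<bullet> outward_normal \<Omega> p = 0 \<and> D \<tau> = \<kappa> *\<^sub>R \<tau>)"

definition uniformly_convex :: "(real^'n::finite) set \<Rightarrow> bool" where
  "uniformly_convex \<Omega> \<longleftrightarrow>
     (\<exists>\<kappa>\<^sub>0>0. \<forall>p\<in>frontier \<Omega>. \<forall>\<kappa>. principal_curvature \<Omega> p \<kappa> \<longrightarrow> \<kappa> \<ge> \<kappa>\<^sub>0)"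

text \<open>The one-sided derivative, from inside the domain, along the outward normal line. For
  functions of class \<open>C\<^sup>1\<close> up to the boundary this is the inner product of the continuously
  extended gradient with the normal.\<close>

definition normal_deriv :: "(real^'n::finite) set \<Rightarrow> (real^'n \<Rightarrow> real) \<Rightarrow> real^'n \<Rightarrow> real" where
  "normal_deriv \<Omega> u x =
     vector_derivative (\<lambda>h. u (x + h *\<^sub>R outward_normal \<Omega> x)) (at 0 within {..0})"

definition orth_proj :: "(real^'n::finite) set \<Rightarrow> real^'n \<Rightarrow> real^'n" where
  "orth_proj W x = (THE y. y \<in> W \<and> x - y \<in> W\<^sup>\<bottom>)"

definition phi :: "(real^'n::finite) set \<Rightarrow> real^'n \<Rightarrow> real" where
  "phi E x = (norm (orth_proj E x))\<^sup>2 / 2"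

definition sub_laplacian ::
  "(real^'n::finite) set \<Rightarrow> (real^'n \<Rightarrow> real) \<Rightarrow> real^'n \<Rightarrow> real" where
  "sub_laplacian V u x = trace (matrix (orth_proj V) ** hessian u x)"

definition k_hessian_solution ::
  "nat \<Rightarrow> (real^'n::finite) set \<Rightarrow> (real^'n \<Rightarrow> real) \<Rightarrow> (real^'n \<Rightarrow> real) \<Rightarrow> (real^'n \<Rightarrow> real) \<Rightarrow> bool"
where
  "k_hessian_solution k \<Omega> f g u \<longleftrightarrow>
     smooth_upto_closure \<Omega> u \<and> admissible k \<Omega> u \<and>
     (\<forall>x\<in>\<Omega>. sigma k (hessian u x) = f x) \<and> (\<forall>x\<in>frontier \<Omega>. u x = g x)"

text \<open>The vanishing on the whole of \<^term>\<open>frontier \<Omega>\<close> concerns, beyond the boundaries of the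
  sections, only the boundary points where the normal is orthogonal to \<open>V = E\<^sup>\<bottom>\<close>.\<close>

definition poisson_correction ::
  "(real^'n::finite) set \<Rightarrow> (real^'n) set \<Rightarrow> (real^'n \<Rightarrow> real) \<Rightarrow> (real^'n \<Rightarrow> real) \<Rightarrow> bool" where
  "poisson_correction \<Omega> E f w \<longleftrightarrow>
     smooth_upto_closure \<Omega> w \<and>
     (\<forall>y\<in>orth_proj E ` \<Omega>.
        let A = (+) y ` (E\<^sup>\<bottom>) in
          (\<forall>x\<in>\<Omega> \<inter> A. sub_laplacian (E\<^sup>\<bottom>) w x = f x) \<and>
          (\<forall>x\<in>top_of_set A frontier_of (\<Omega> \<inter> A). w x = 0)) \<and>
     (\<forall>x\<in>frontier \<Omega>. w x = 0)"

definition transversal_boundary :: "(real^'n::finite) set \<Rightarrow> (real^'n) set \<Rightarrow> (real^'n) set" where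
  "transversal_boundary \<Omega> E =
     {x\<in>frontier \<Omega>. norm (orth_proj (E\<^sup>\<bottom>) (outward_normal \<Omega> x)) > 0}"

end

theory Submission
  imports Defs "HOL-Computational_Algebra.Polynomial"
begin

text \<open>Write \<open>P\<close> for the projection onto \<open>E\<close>, \<open>V = E\<^sup>\<bottom>\<close> and \<open>\<delta> = t\<^sup>-\<^sup>k\<close>. Since \<open>P\<close> has rank
  \<open>k - 1\<close>, one has \<open>\<sigma>\<^sub>k (P + \<delta> M) = \<delta> tr (P\<^sub>V M) + O(\<delta>\<^sup>2)\<close> uniformly for bounded \<open>M\<close>, while the
  lower \<open>\<sigma>\<^sub>j (P + \<delta> M)\<close> stay positive. As \<open>w\<close> is smooth up to the boundary, the functions
  \<open>t \<phi> + t \<delta> (1 \<plusminus> \<epsilon>) w\<close> are therefore strict sub- and supersolutions as soon as \<open>\<epsilon>\<close> is a large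
  multiple of \<open>\<delta>\<close>. They have the boundary values of the solution \<open>u\<close>, so the comparison
  principle gives \<open>\<bar>u - t \<phi> - t \<delta> w\<bar> \<le> \<epsilon> t \<delta> \<bar>w\<bar>\<close>. Both sides vanish on the boundary, and the
  normal derivatives differ by \<open>O(t\<^sup>1\<^sup>-\<^sup>2\<^sup>k)\<close>, which is within the claimed error since \<open>t\<^sup>-\<^sup>k \<le> t\<^sup>-\<^sup>k\<^sup>/\<^sup>2\<close>.\<close>

section \<open>Elementary symmetric functions\<close>

text \<open>The comparison principle rests on one algebraic fact: starting from a matrix in the
  cone, \<open>sigma k\<close> does not decrease when a nonnegative symmetric matrix is added.
  Splitting the added matrix into rank-one pieces reduces this to positivity of elementary symmetric
  functions with one index deleted, which Newton's inequality gives. The obstacle is that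
  \<open>eigenvalues\<close> is an arbitrary choice without continuity, so it cannot be perturbed
  directly. Every \<open>sigma j A\<close> is therefore read as a coefficient of
  \<open>det (mat 1 + x *\<^sub>R A)\<close>, a polynomial in \<open>x\<close>: determinants are
  estimated at finitely many \<open>x\<close>, and interpolation returns the coefficients. The same
  generating polynomial defines \<open>esym\<close>, over any finite index set so that indices can
  be deleted. The size of \<epsilon> is forced: \<epsilon> f \<delta> has to absorb the second-order
  error C \<delta>^2, and f is bounded below. Since the barriers deviate from the expansion by a
  multiple of w, a function vanishing on the boundary, the sup-norm comparison passes directly to
  normal derivatives.\<close>

definition esym :: "'a set \<Rightarrow> ('a \<Rightarrow> real) \<Rightarrow> nat \<Rightarrow> real" where
  "esym S l j = coeff (\<Prod>i\<in>S. [:1, l i:]) j"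

lemma esym_0 [simp]: "esym S l 0 = 1"
  by (induction S rule: infinite_finite_induct) (auto simp: esym_def coeff_mult)

lemma esym_remove:
  assumes "finite S" "i \<in> S"
  shows "esym S l (Suc j) = esym (S - {i}) l (Suc j) + l i * esym (S - {i}) l j"
  by (simp add: esym_def prod.remove[OF assms])

text \<open>Differentiating the generating polynomial by the product rule gives this identity
  coefficientwise; it is Euler's identity for a homogeneous polynomial of degree
  \<open>Suc j\<close>.\<close>

lemma sum_esym_remove:
  assumes "finite S"
  shows "(\<Sum>i\<in>S. l i * esym (S - {i}) l j) = real (Suc j) * esym S l (Suc j)"
proof -
  have "pderiv (\<Prod>i\<in>S. [:1, l i:]) = (\<Sum>i\<in>S. (\<Prod>m\<in>S - {i}. [:1, l m:]) * [:l i:])"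
    by (simp add: pderiv_prod pderiv_pCons)
  also have "\<dots> = (\<Sum>i\<in>S. smult (l i) (\<Prod>m\<in>S - {i}. [:1, l m:]))"
    by simp
  finally have "coeff (pderiv (\<Prod>i\<in>S. [:1, l i:])) j = coeff (\<Sum>i\<in>S. smult (l i) (\<Prod>m\<in>S - {i}. [:1, l m:])) j"
    by simp
  then show ?thesis
    by (simp add: esym_def coeff_pderiv coeff_sum)
qed

text \<open>Newton's inequality without real-rootedness and Rolle: the difference of the two sides is
  the sum of \<open>l\<^sub>i\<^sup>2\<close> times the same kind of difference, one degree lower, for \<open>S - {i}\<close>.\<close>

lemma esym_newton:
  assumes "finite S"
  shows "real (j + 2) * (esym S l j * esym S l (j + 2)) \<le> real (j + 1) * (esym S l (j + 1))\<^sup>2"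
  using assms
proof (induction j arbitrary: S)
  case 0
  have e: "esym S l (Suc 0) = (\<Sum>i\<in>S. l i)" "2 * esym S l 2 = (\<Sum>i\<in>S. l i * esym (S - {i}) l 1)"
    using sum_esym_remove[OF 0, of l 0] sum_esym_remove[OF 0, of l 1] by (simp_all add: numeral_2_eq_2)
  \<comment> \<open>The base case is \<open>2 e_2 = e_1^2 - (sum of squares)\<close>.\<close>
  have "(\<Sum>i\<in>S. l i * esym (S - {i}) l 1) = (\<Sum>i\<in>S. l i * (esym S l 1 - l i))"
    by (intro sum.cong refl) (use esym_remove[OF 0, of _ l 0] in simp)
  also have "\<dots> = (esym S l 1)\<^sup>2 - (\<Sum>i\<in>S. (l i)\<^sup>2)"
    by (simp add: algebra_simps sum_subtractf power2_eq_square e sum_distrib_left)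
  also have "\<dots> \<le> (esym S l 1)\<^sup>2"
    by (simp add: sum_nonneg)
  finally show ?case
    using e by (simp add: numeral_2_eq_2)
next
  case (Suc j)
  let ?e = "esym S l" and ?r = "\<lambda>i. esym (S - {i}) l"
  \<comment> \<open>The right-hand side is linear in the products \<open>l i * ?r i m\<close>, whose
    sums over \<open>i\<close> are known from \<open>sum_esym_remove\<close>; the mixed terms cancel
    by the recursion \<open>esym_remove\<close>.\<close>
  have *: "(l i * ?r i (Suc j))\<^sup>2 - (l i * ?r i j) * (l i * ?r i (j + 2))
      = ?e (j + 2) * (l i * ?r i (Suc j)) - ?e (Suc j) * (l i * ?r i (j + 2))" if "i \<in> S" for i
    using esym_remove[OF Suc.prems that, of l "Suc j"] esym_remove[OF Suc.prems that, of l j]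
    by (simp add: algebra_simps power2_eq_square)
  have "0 \<le> (\<Sum>i\<in>S. (l i)\<^sup>2 * ((?r i (Suc j))\<^sup>2 - ?r i j * ?r i (j + 2)))"
  proof (intro sum_nonneg mult_nonneg_nonneg)
    fix i assume "i \<in> S"
    have "real (j + 2) * (?r i j * ?r i (j + 2)) \<le> real (j + 1) * (?r i (j + 1))\<^sup>2"
      using Suc.IH Suc.prems by blast
    \<comment> \<open>The factors \<open>j + 2\<close> and \<open>j + 1\<close> of the induction
      hypothesis are dropped here: if the product on the left is positive they only strengthen the
      inequality, and otherwise a square dominates it trivially.\<close>
    then have "real (j + 1) * (?r i j * ?r i (j + 2) - (?r i (j + 1))\<^sup>2) \<le> - (?r i j * ?r i (j + 2))"
      by (simp add: algebra_simps)
    then show "0 \<le> (?r i (Suc j))\<^sup>2 - ?r i j * ?r i (j + 2)"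
    proof (cases "?r i j * ?r i (j + 2) \<le> 0")
      case False
      then have "real (j + 1) * (?r i j * ?r i (j + 2) - (?r i (j + 1))\<^sup>2) \<le> 0"
        using \<open>real (j + 1) * _ \<le> _\<close> by linarith
      then show ?thesis
        by (simp add: mult_le_0_iff)
    qed (smt (verit) zero_le_power2)
  qed auto
  also have "\<dots> = (\<Sum>i\<in>S. (l i * ?r i (Suc j))\<^sup>2 - (l i * ?r i j) * (l i * ?r i (j + 2)))"
    by (intro sum.cong) (auto simp: algebra_simps power2_eq_square)
  also have "\<dots> = (\<Sum>i\<in>S. ?e (j + 2) * (l i * ?r i (Suc j)) - ?e (Suc j) * (l i * ?r i (j + 2)))"
    using * by simp
  also have "\<dots> = ?e (j + 2) * (\<Sum>i\<in>S. l i * ?r i (Suc j)) - ?e (Suc j) * (\<Sum>i\<in>S. l i * ?r i (j + 2))"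
    by (simp only: sum_subtractf sum_distrib_left)
  also have "\<dots> = ?e (j + 2) * (real (j + 2) * ?e (j + 2)) - ?e (Suc j) * (real (j + 3) * ?e (j + 3))"
    unfolding sum_esym_remove[OF Suc.prems] by (simp add: numeral_eq_Suc)
  finally show ?case
    by (simp add: algebra_simps power2_eq_square numeral_eq_Suc)
qed

text \<open>Deleting one entry maps the cone of order \<open>k\<close> into that of order
  \<open>k - 1\<close>. At the first degree that fails to be positive, positivity of two consecutive
  \<open>esym S l\<close> would force a strict violation of Newton's inequality for
  \<open>S - {i}\<close>.\<close>

lemma esym_remove_pos:
  assumes S: "finite S" "i \<in> S" and pos: "\<And>j. j \<le> k \<Longrightarrow> 0 < esym S l j"
  shows "j < k \<Longrightarrow> 0 < esym (S - {i}) l j"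
proof (induction j)
  case (Suc j)
  let ?r = "esym (S - {i}) l"
  have r: "0 < ?r j"
    using Suc by simp
  \<comment> \<open>The second inequality uses degree \<open>j + 2\<close> of the full set, which is
    at most \<open>k\<close> because \<open>Suc j < k\<close>; this is where one order is
    lost.\<close>
  have 1: "0 < ?r (Suc j) + l i * ?r j" and 2: "0 < ?r (j + 2) + l i * ?r (Suc j)"
    using esym_remove[OF S, of l j] esym_remove[OF S, of l "Suc j"] pos[of "Suc j"] pos[of "j + 2"] Suc.prems
    by auto
  have N: "real (j + 2) * (?r j * ?r (j + 2)) \<le> real (j + 1) * (?r (j + 1))\<^sup>2"
    by (rule esym_newton) (use S in simp)
  show ?case
  proof (rule ccontr)
    assume "\<not> 0 < ?r (Suc j)"
    then have neg: "?r (Suc j) \<le> 0" by simp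
    have "(?r (Suc j))\<^sup>2 \<le> - (l i * ?r j) * ?r (Suc j)"
      using mult_right_mono_neg[of "- (l i * ?r j)" "?r (Suc j)" "?r (Suc j)"] 1 neg
      by (simp add: power2_eq_square)
    also have "\<dots> = ?r j * (- (l i * ?r (Suc j)))"
      by simp
    also have "\<dots> < ?r j * ?r (j + 2)"
      using 2 r by (intro mult_strict_left_mono) auto
    finally have lt: "(?r (Suc j))\<^sup>2 < ?r j * ?r (j + 2)" .
    \<comment> \<open>Together with \<open>N\<close> this yields
      \<open>(j + 2) P \<le> (j + 1) P\<close> for \<open>P = ?r j * ?r (j + 2)\<close>, impossible
      since \<open>P > 0\<close>.\<close>
    then have "real (j + 1) * (?r (Suc j))\<^sup>2 \<le> real (j + 1) * (?r j * ?r (j + 2))"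
      by (intro mult_left_mono) auto
    moreover have "0 < ?r j * ?r (j + 2)"
      using lt zero_le_power2[of "?r (Suc j)"] by linarith
    ultimately show False
      using N by (simp add: algebra_simps)
  qed
qed simp

text \<open>Multiplying out the linear factors, the set of indices from which the non-constant term
  is taken contributes a monomial of degree its cardinality.\<close>

lemma elem_sym_eq_esym: "elem_sym j \<mu> = esym UNIV (($) \<mu>) j"
proof -
  have "(\<Prod>i\<in>UNIV. [:1, \<mu> $ i:]) = (\<Prod>i\<in>UNIV. monom (\<mu> $ i) 1 + 1)"
    by (intro prod.cong) (auto simp: monom_Suc monom_0 one_pCons)
  also have "\<dots> = (\<Sum>S\<in>Pow UNIV. (\<Prod>i\<in>S. monom (\<mu> $ i) 1) * (\<Prod>i\<in>UNIV - S. 1))"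
    by (rule prod_add) simp
  also have "\<dots> = (\<Sum>S\<in>Pow UNIV. monom (\<Prod>i\<in>S. \<mu> $ i) (card S))"
  proof (intro sum.cong refl)
    fix S :: "'a set"
    have "finite S" by simp
    then show "(\<Prod>i\<in>S. monom (\<mu> $ i) 1) * (\<Prod>i\<in>UNIV - S. 1) = monom (\<Prod>i\<in>S. \<mu> $ i) (card S)"
      by (induction S) (auto simp: mult_monom simp flip: one_pCons)
  qed
  finally show ?thesis
    unfolding esym_def elem_sym_def
    by (simp add: coeff_sum sum.If_cases)
qed

section \<open>Symmetric matrices\<close>

definition diag_mat :: "('n::finite \<Rightarrow> real) \<Rightarrow> real^'n^'n" where
  "diag_mat d = (\<chi> i j. if i = j then d i else 0)"

lemma dot_symmetric_matrix:
  fixes A :: "real^'n::finite^'n"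
  assumes "transpose A = A"
  shows "x \<bullet> (A *v y) = (A *v x) \<bullet> y"
  by (metis assms dot_lmul_matrix transpose_matrix_vector)

text \<open>The maximiser of the quadratic form on the unit sphere of an invariant subspace is an
  eigenvector.\<close>

lemma symmetric_eigenvector_in_subspace:
  fixes A :: "real^'n::finite^'n"
  assumes A: "transpose A = A" and W: "subspace W" "\<And>x. x \<in> W \<Longrightarrow> A *v x \<in> W" "W \<noteq> {0}"
  obtains v \<mu> where "v \<in> W" "norm v = 1" "A *v v = \<mu> *\<^sub>R v"
proof -
  let ?S = "sphere 0 1 \<inter> W"
  obtain w where w: "w \<in> W" "w \<noteq> 0"
    using W(1,3) subspace_0 by blast
  have "compact ?S"
    using W(1) by (intro compact_Int_closed closed_subspace) auto
  moreover have "w /\<^sub>R norm w \<in> ?S"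
    using w W(1) by (simp add: subspace_scale)
  moreover have "continuous_on ?S (\<lambda>x. x \<bullet> (A *v x))"
    by (intro continuous_intros linear_continuous_on matrix_vector_mul_bounded_linear)
  ultimately obtain v where v: "v \<in> ?S" and max: "\<And>x. x \<in> ?S \<Longrightarrow> x \<bullet> (A *v x) \<le> v \<bullet> (A *v v)"
    using continuous_attains_sup[of ?S "\<lambda>x. x \<bullet> (A *v x)"] by blast
  define \<mu> where "\<mu> = v \<bullet> (A *v v)"
  \<comment> \<open>A quadratic form that is nonnegative on \<open>W\<close> and vanishes at the
    maximiser \<open>v\<close>, so its first variation at \<open>v\<close> must vanish too.\<close>
  define q where "q x = \<mu> * (x \<bullet> x) - x \<bullet> (A *v x)" for x
  have q: "0 \<le> q x" if "x \<in> W" for x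
  proof (cases "x = 0")
    case False
    have "x /\<^sub>R norm x \<in> ?S"
      using that False W(1) by (simp add: subspace_scale)
    from max[OF this] have "(x \<bullet> (A *v x)) / (norm x)\<^sup>2 \<le> \<mu>"
      by (simp add: \<mu>_def matrix_vector_mult_scaleR power2_eq_square divide_inverse algebra_simps)
    then show ?thesis
      using False by (simp add: q_def field_simps power2_norm_eq_inner)
  qed (simp add: q_def)
  let ?y = "\<mu> *\<^sub>R v - A *v v"
  have vv: "v \<in> W" "v \<bullet> v = 1"
    using v by (auto simp: norm_eq_1)
  have yW: "?y \<in> W"
    using vv W(1,2) by (intro subspace_diff subspace_scale) auto
  \<comment> \<open>The variation is taken in the direction of the eigenvector defect
    \<open>?y\<close> itself, which makes the linear coefficient
    \<open>2 * (?y \<bullet> ?y)\<close>.\<close>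
  have lin: "0 \<le> 2 * (?y \<bullet> ?y) * s + q ?y * s\<^sup>2" for s
  proof -
    have "q (v + s *\<^sub>R ?y) = 2 * (?y \<bullet> ?y) * s + q ?y * s\<^sup>2"
      using dot_symmetric_matrix[OF A, of v ?y] vv
      unfolding q_def matrix_vector_right_distrib matrix_vector_mult_scaleR
      by (simp add: inner_add_left inner_add_right inner_diff_left inner_diff_right inner_commute
          \<mu>_def[symmetric] power2_eq_square algebra_simps)
    then show ?thesis
      using q[of "v + s *\<^sub>R ?y"] vv yW W(1) by (simp add: subspace_add subspace_scale)
  qed
  have "?y \<bullet> ?y = 0"
  proof (rule ccontr)
    assume "?y \<bullet> ?y \<noteq> 0"
    then have yy: "0 < ?y \<bullet> ?y" by simp
    \<comment> \<open>Adding 1 keeps the denominator of the test value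
      \<open>s = - (?y \<bullet> ?y) / b\<close> positive even when \<open>q ?y = 0\<close>.\<close>
    define b where "b = q ?y + 1"
    have b: "0 < b" using q[OF yW] by (simp add: b_def)
    have "2 * (?y \<bullet> ?y) * (- (?y \<bullet> ?y) / b) + q ?y * (- (?y \<bullet> ?y) / b)\<^sup>2
        \<le> 2 * (?y \<bullet> ?y) * (- (?y \<bullet> ?y) / b) + b * (- (?y \<bullet> ?y) / b)\<^sup>2"
      by (intro add_left_mono mult_right_mono) (auto simp: b_def)
    also have "\<dots> = - (?y \<bullet> ?y)\<^sup>2 / b"
      using b by (simp add: power2_eq_square field_simps)
    also have "\<dots> < 0"
      using b yy by simp
    finally show False
      using lin[of "- (?y \<bullet> ?y) / b"] by linarith
  qed
  then have "A *v v = \<mu> *\<^sub>R v" by simp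
  then show ?thesis using that vv v by auto
qed

text \<open>By symmetry the orthogonal complement of a set of eigenvectors is invariant, and it is
  nonzero as long as there are fewer than \<open>CARD('n)\<close> of them; it then contains a
  further eigenvector.\<close>

lemma orthonormal_eigenvectors:
  fixes A :: "real^'n::finite^'n"
  assumes A: "transpose A = A" and "m \<le> CARD('n)"
  shows "\<exists>B. finite B \<and> card B = m \<and> pairwise orthogonal B \<and> (\<forall>v\<in>B. norm v = 1 \<and> (\<exists>\<mu>. A *v v = \<mu> *\<^sub>R v))"
  using assms(2)
proof (induction m)
  case 0
  show ?case by (intro exI[of _ "{}"]) auto
next
  case (Suc m)
  then obtain B where B: "finite B" "card B = m" "pairwise orthogonal B"
      "\<And>v. v \<in> B \<Longrightarrow> norm v = 1" "\<And>v. v \<in> B \<Longrightarrow> \<exists>\<mu>. A *v v = \<mu> *\<^sub>R v"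
    by auto
  let ?W = "B\<^sup>\<bottom>"
  have "dim (span B) < DIM(real^'n)"
    using dim_le_card'[OF B(1)] B(2) Suc.prems by simp
  then obtain x where x: "x \<noteq> 0" "\<And>y. y \<in> span (span B) \<Longrightarrow> orthogonal x y"
    using orthogonal_to_subspace_exists[of B] by (metis dim_span span_span)
  have 1: "?W \<noteq> {0}"
    using x by (auto simp: orthogonal_comp_def orthogonal_commute span_base)
  have 2: "A *v x \<in> ?W" if "x \<in> ?W" for x
  proof -
    have "y \<bullet> (A *v x) = 0" if "y \<in> B" for y
      using B(5)[OF that] \<open>x \<in> ?W\<close> that
      by (auto simp: dot_symmetric_matrix[OF A] orthogonal_comp_def orthogonal_def)
    then show ?thesis by (simp add: orthogonal_comp_def orthogonal_def)
  qed
  obtain v \<mu> where v: "v \<in> ?W" "norm v = 1" "A *v v = \<mu> *\<^sub>R v"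
    using symmetric_eigenvector_in_subspace[OF A subspace_orthogonal_comp 2 1] by blast
  have "v \<notin> B"
    using v by (auto simp: orthogonal_comp_def orthogonal_def)
  then show ?case
    using B v by (intro exI[of _ "insert v B"])
      (auto simp: pairwise_insert orthogonal_comp_def orthogonal_commute)
qed

lemma symmetric_diagonalizable:
  fixes A :: "real^'n::finite^'n"
  assumes A: "transpose A = A"
  obtains Q d where "orthogonal_matrix Q" "A = Q ** diag_mat d ** transpose Q"
proof -
  obtain B where B: "finite B" "card B = CARD('n)" "pairwise orthogonal B"
      "\<And>v. v \<in> B \<Longrightarrow> norm v = 1" "\<And>v. v \<in> B \<Longrightarrow> \<exists>\<mu>. A *v v = \<mu> *\<^sub>R v"
    using orthonormal_eigenvectors[OF A order_refl] by auto
  obtain g where g: "bij_betw g (UNIV :: 'n set) B"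
    using finite_same_card_bij[OF finite_class.finite_UNIV B(1)] B(2) by auto
  then have gB: "g i \<in> B" for i
    by (auto simp: bij_betw_def)
  then have "\<forall>i. \<exists>\<mu>. A *v g i = \<mu> *\<^sub>R g i"
    using B(5) by blast
  from choice[OF this] obtain d where d: "\<And>i. A *v g i = d i *\<^sub>R g i"
    by blast
  define Q :: "real^'n^'n" where "Q = (\<chi> r c. g c $ r)"
  have col: "column i Q = g i" for i
    by (simp add: Q_def column_def vec_eq_iff)
  have Q: "orthogonal_matrix Q"
    unfolding orthogonal_matrix_orthonormal_columns
  proof (intro conjI allI impI)
    fix i j :: 'n assume "i \<noteq> j"
    then have "g i \<noteq> g j" using g by (auto simp: bij_betw_def inj_on_def)
    then show "orthogonal (column i Q) (column j Q)"
      using B(3) gB by (auto simp: col pairwise_def)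
  qed (use B(4) gB col in auto)
  have "A ** Q = Q ** diag_mat d"
  proof -
    have "(A ** Q) $ r $ c = (Q ** diag_mat d) $ r $ c" for r c
    proof -
      have "(A ** Q) $ r $ c = (A *v g c) $ r"
        by (simp add: matrix_matrix_mult_def matrix_vector_mult_def Q_def)
      also have "\<dots> = (Q ** diag_mat d) $ r $ c"
        by (simp add: d matrix_matrix_mult_def Q_def diag_mat_def if_distrib cong: if_cong)
      finally show ?thesis .
    qed
    then show ?thesis by (simp add: vec_eq_iff)
  qed
  then have "A = Q ** diag_mat d ** transpose Q"
    using Q by (metis matrix_mul_assoc matrix_mul_rid orthogonal_matrix_def)
  with Q that show ?thesis by blast
qed

section \<open>The functions \<open>sigma j\<close> as coefficients of a determinant\<close>

lemma matrix_algebra_simps: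
  fixes A B :: "real^'n::finite^'m::finite" and C D :: "real^'k::finite^'n"
  shows "(A + B) ** C = A ** C + B ** C" "(A - B) ** C = A ** C - B ** C" "(c *\<^sub>R A) ** C = c *\<^sub>R (A ** C)"
    "A ** (C + D) = A ** C + A ** D" "A ** (C - D) = A ** C - A ** D" "A ** (c *\<^sub>R C) = c *\<^sub>R (A ** C)"
  by (simp_all add: matrix_matrix_mult_def vec_eq_iff sum.distrib sum_subtractf sum_distrib_left algebra_simps)

lemma det_orthogonal_conjugate:
  fixes M :: "real^'n::finite^'n"
  assumes "orthogonal_matrix Q"
  shows "det (Q ** M ** transpose Q) = det M"
  using det_orthogonal_matrix[OF assms] by (auto simp: det_mul)

lemma orthogonal_conjugate_mat:
  fixes Q :: "real^'n::finite^'n"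
  assumes "orthogonal_matrix Q"
  shows "Q ** mat c ** transpose Q = mat c"
proof -
  have "Q ** mat c = c *\<^sub>R Q"
    by (simp add: matrix_matrix_mult_def mat_def vec_eq_iff if_distrib cong: if_cong)
  then show ?thesis
    using assms by (simp add: matrix_algebra_simps orthogonal_matrix_def) (simp add: mat_def vec_eq_iff)
qed

lemma det_scaleR: "det (c *\<^sub>R A) = c ^ CARD('n) * det A" for A :: "real^'n::finite^'n"
proof -
  have "c *\<^sub>R A = (\<chi> i. c *s A $ i)"
    by (simp add: vec_eq_iff)
  then show ?thesis
    using det_rows_mul[of "\<lambda>_. c" "\<lambda>i. A $ i"] by simp
qed

text \<open>\<open>eigenvalues\<close> is given by \<open>SOME\<close>, so its defining property
  becomes available only through a witness, which diagonalisation supplies.\<close>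

lemma det_mat_minus_eigenvalues:
  fixes A :: "real^'n::finite^'n"
  assumes "transpose A = A"
  shows "det (mat s - A) = (\<Prod>i\<in>UNIV. s - eigenvalues A $ i)"
proof -
  obtain Q d where Q: "orthogonal_matrix Q" "A = Q ** diag_mat d ** transpose Q"
    using symmetric_diagonalizable[OF assms] by blast
  have "det (mat s - A) = (\<Prod>i\<in>UNIV. s - (\<chi> i. d i) $ i)" for s
  proof -
    have "mat s - A = Q ** (mat s - diag_mat d) ** transpose Q"
      using Q by (simp add: matrix_algebra_simps orthogonal_conjugate_mat)
    then have "det (mat s - A) = det (mat s - diag_mat d)"
      using Q det_orthogonal_conjugate by metis
    also have "\<dots> = (\<Prod>i\<in>UNIV. s - d i)"
      by (subst det_diagonal) (auto simp: mat_def diag_mat_def)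
    finally show ?thesis by simp
  qed
  then have "\<exists>\<mu>::real^'n. \<forall>s. det (mat s - A) = (\<Prod>i\<in>UNIV. s - \<mu> $ i)"
    by (intro exI[of _ "\<chi> i. d i"]) simp
  then show ?thesis
    unfolding eigenvalues_def by (rule someI2_ex) blast
qed

text \<open>This reverses the characteristic polynomial: for \<open>x \<noteq> 0\<close> factor out
  \<open>- x\<close> and evaluate at \<open>- 1 / x\<close>.\<close>

lemma det_one_plus_eigenvalues:
  fixes A :: "real^'n::finite^'n"
  assumes "transpose A = A"
  shows "det (mat 1 + x *\<^sub>R A) = (\<Prod>i\<in>UNIV. 1 + x * eigenvalues A $ i)"
proof (cases "x = 0")
  case False
  have "mat 1 + x *\<^sub>R A = (- x) *\<^sub>R (mat (- 1 / x) - A)"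
    using False by (simp add: vec_eq_iff mat_def algebra_simps)
  then have "det (mat 1 + x *\<^sub>R A) = (- x) ^ CARD('n) * (\<Prod>i\<in>UNIV. - 1 / x - eigenvalues A $ i)"
    using det_mat_minus_eigenvalues[OF assms] by (simp only: det_scaleR)
  also have "\<dots> = (\<Prod>i\<in>UNIV. (- x) * (- 1 / x - eigenvalues A $ i))"
    by (simp only: prod.distrib prod_constant)
  also have "\<dots> = (\<Prod>i\<in>UNIV. 1 + x * eigenvalues A $ i)"
    using False by (intro prod.cong) (auto simp: field_simps)
  finally show ?thesis .
qed simp

text \<open>The gateway for all later computations of \<open>sigma\<close>: any polynomial with the
  values \<open>det (mat 1 + x *\<^sub>R A)\<close> is the generating polynomial of the eigenvalues,
  so the chosen eigenvalues themselves need not be identified.\<close>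

lemma sigma_eq_coeff:
  fixes A :: "real^'n::finite^'n"
  assumes "transpose A = A" and "\<And>x. poly q x = det (mat 1 + x *\<^sub>R A)"
  shows "sigma j A = coeff q j"
proof -
  have "poly q x = poly (\<Prod>i\<in>UNIV. [:1, eigenvalues A $ i:]) x" for x
    by (simp add: assms det_one_plus_eigenvalues poly_prod)
  then have "q = (\<Prod>i\<in>UNIV. [:1, eigenvalues A $ i:])"
    by (simp add: poly_eq_poly_eq_iff[symmetric] fun_eq_iff)
  then show ?thesis
    by (simp add: sigma_def elem_sym_eq_esym esym_def)
qed

lemma transpose_conjugate_diag:
  "transpose (Q ** diag_mat d ** transpose Q) = Q ** diag_mat d ** transpose Q"
proof -
  have "transpose (diag_mat d) = diag_mat d"
    by (auto simp: transpose_def diag_mat_def vec_eq_iff)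
  then show ?thesis
    by (simp add: matrix_transpose_mul matrix_mul_assoc)
qed

lemma orthogonal_conjugate_one_plus:
  fixes Q :: "real^'n::finite^'n"
  assumes "orthogonal_matrix Q"
  shows "mat 1 + x *\<^sub>R (Q ** M ** transpose Q) = Q ** (mat 1 + x *\<^sub>R M) ** transpose Q"
  using orthogonal_conjugate_mat[OF assms, of 1]
  by (simp add: matrix_algebra_simps)

lemma sigma_conjugate_diag:
  fixes Q :: "real^'n::finite^'n"
  assumes "orthogonal_matrix Q"
  shows "sigma j (Q ** diag_mat d ** transpose Q) = esym UNIV d j"
  unfolding esym_def
proof (rule sigma_eq_coeff[OF transpose_conjugate_diag])
  fix x
  have "det (mat 1 + x *\<^sub>R diag_mat d) = (\<Prod>i\<in>UNIV. 1 + x * d i)"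
    by (subst det_diagonal) (auto simp: mat_def diag_mat_def)
  then show "poly (\<Prod>i\<in>UNIV. [:1, d i:]) x = det (mat 1 + x *\<^sub>R (Q ** diag_mat d ** transpose Q))"
    by (simp add: orthogonal_conjugate_one_plus[OF assms] det_orthogonal_conjugate[OF assms] poly_prod)
qed

lemma sigma_scaleR:
  fixes A :: "real^'n::finite^'n"
  assumes "transpose A = A"
  shows "sigma j (c *\<^sub>R A) = c ^ j * sigma j A"
proof -
  let ?p = "\<Prod>i\<in>UNIV. [:1, eigenvalues A $ i:]"
  have "sigma j (c *\<^sub>R A) = coeff (pcompose ?p [:0, c:]) j"
  proof (rule sigma_eq_coeff)
    show "transpose (c *\<^sub>R A) = c *\<^sub>R A"
      using assms by (simp add: transpose_def vec_eq_iff)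
    fix x show "poly (pcompose ?p [:0, c:]) x = det (mat 1 + x *\<^sub>R c *\<^sub>R A)"
      using det_one_plus_eigenvalues[OF assms, of "x * c"]
      by (simp add: poly_pcompose poly_prod)
  qed
  also have "\<dots> = c ^ j * coeff ?p j"
    by (rule coeff_pcompose_linear)
  also have "coeff ?p j = sigma j A"
    by (simp add: sigma_def elem_sym_eq_esym esym_def)
  finally show ?thesis .
qed

section \<open>Rank-one updates and monotonicity of \<open>sigma\<close>\<close>

lemma det_diag_except_row:
  fixes b :: "real^'n::finite"
  shows "det (\<chi> l. if l = i then b else d l *\<^sub>R axis l 1) = b $ i * (\<Prod>l\<in>UNIV - {i}. d l)"
proof -
  let ?M = "\<chi> l. if l = i then b else d l *\<^sub>R axis l 1"
  have 0: "(\<Prod>l\<in>UNIV. ?M $ l $ p l) = 0" if p: "p permutes UNIV" "p \<noteq> id" for p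
  proof -
    \<comment> \<open>A permutation fixing every index but \<open>i\<close> fixes \<open>i\<close>
      as well. So any other permutation picks an off-diagonal zero from some diagonal row.\<close>
    have "\<exists>l. l \<noteq> i \<and> p l \<noteq> l"
    proof (rule ccontr)
      assume "\<not> ?thesis"
      then have fixed: "\<And>l. l \<noteq> i \<Longrightarrow> p l = l" by blast
      then have "p i = i"
        using permutes_inj[OF p(1)] by (metis injD)
      with fixed show False
        using p(2) by (metis eq_id_iff)
    qed
    then show ?thesis
      by (intro prod_zero) (auto simp: axis_def)
  qed
  have "det ?M = (\<Sum>p\<in>{id}. of_int (sign p) * (\<Prod>l\<in>UNIV. ?M $ l $ p l))"
    unfolding det_def by (rule sum.mono_neutral_right) (use 0 in \<open>auto simp: permutes_id\<close>)
  also have "\<dots> = b $ i * (\<Prod>l\<in>UNIV - {i}. d l)"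
    by (simp add: prod.remove[of UNIV i] sign_id axis_def)
  finally show ?thesis .
qed

text \<open>The matrix determinant lemma in a division-free form, valid also when some
  \<open>d i\<close> vanish. The multiples of \<open>b\<close> are switched on row by row; by
  multilinearity, each contributes the determinant with that row replaced by
  \<open>b\<close>.\<close>

lemma det_diag_plus_rank_one:
  fixes b :: "real^'n::finite"
  shows "det (\<chi> i. d i *\<^sub>R axis i 1 + a i *\<^sub>R b)
    = (\<Prod>i\<in>UNIV. d i) + (\<Sum>i\<in>UNIV. a i * b $ i * (\<Prod>l\<in>UNIV - {i}. d l))"
proof -
  let ?r = "\<lambda>S l. d l *\<^sub>R axis l 1 + (if l \<in> S then a l *\<^sub>R b else 0)"
  \<comment> \<open>Once a row equals \<open>b\<close>, multiples of \<open>b\<close> in the other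
    rows do not change the determinant; hence no terms of second order in \<open>a\<close>
    arise.\<close>
  have 1: "det (\<chi> l. if l = i then b else ?r S l) = b $ i * (\<Prod>l\<in>UNIV - {i}. d l)"
    if "finite S" "i \<notin> S" for i S
    using that
  proof (induction S)
    case (insert m S)
    have "det (\<chi> l. if l = i then b else ?r (insert m S) l)
        = det (\<chi> l. if l = m then ?r S m + a m *s b else if l = i then b else ?r S l)"
      using insert by (intro arg_cong[of _ _ det]) (auto simp: vec_eq_iff)
    also have "\<dots> = det (\<chi> l. if l = m then ?r S m else if l = i then b else ?r S l)
        + a m * det (\<chi> l. if l = m then b else if l = i then b else ?r S l)"
      by (simp only: det_row_add det_row_mul)
    also have "det (\<chi> l. if l = m then b else if l = i then b else ?r S l) = 0"
      using insert by (intro det_identical_rows[of m i]) (auto simp: row_def)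
    also have "(\<chi> l. if l = m then ?r S m else if l = i then b else ?r S l) = (\<chi> l. if l = i then b else ?r S l)"
      using insert by (auto simp: vec_eq_iff)
    finally show ?case
      using insert by simp
  qed (simp add: det_diag_except_row cong: if_cong)
  have "det (\<chi> l. ?r S l) = (\<Prod>i\<in>UNIV. d i) + (\<Sum>i\<in>S. a i * b $ i * (\<Prod>l\<in>UNIV - {i}. d l))"
    if "finite S" for S
    using that
  proof (induction S)
    case empty
    show ?case by (subst det_diagonal) (auto simp: axis_def)
  next
    case (insert m S)
    have "det (\<chi> l. ?r (insert m S) l)
        = det (\<chi> l. if l = m then ?r S m + a m *s b else ?r S l)"
      using insert by (intro arg_cong[of _ _ det]) (auto simp: vec_eq_iff)
    also have "\<dots> = det (\<chi> l. if l = m then ?r S m else ?r S l) + a m * det (\<chi> l. if l = m then b else ?r S l)"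
      by (simp only: det_row_add det_row_mul)
    also have "(\<chi> l. if l = m then ?r S m else ?r S l) = (\<chi> l. ?r S l)"
      by (auto simp: vec_eq_iff)
    finally show ?case
      using insert 1[of S m] by simp
  qed
  from this[of UNIV] show ?thesis by simp
qed

definition outer :: "real^'n::finite \<Rightarrow> real^'n^'n" where
  "outer v = (\<chi> i j. v $ i * v $ j)"

lemma conjugate_outer: "Q ** outer v ** transpose Q = outer (Q *v v)" for Q :: "real^'n::finite^'n"
proof -
  have "(Q ** outer v) $ r $ m = (Q *v v) $ r * v $ m" for r m
    by (simp add: outer_def matrix_matrix_mult_def matrix_vector_mult_def sum_distrib_right mult.assoc)
  then have "(Q ** outer v ** transpose Q) $ r $ c = (Q *v v) $ r * (\<Sum>m\<in>UNIV. Q $ c $ m * v $ m)" for r c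
    by (subst matrix_matrix_mult_def) (simp add: transpose_def sum_distrib_left mult_ac)
  then show ?thesis
    by (simp add: vec_eq_iff outer_def) (simp add: matrix_vector_mult_def)
qed

text \<open>After rotation the determinant of the diagonal plus rank-one matrix is a combination of
  the generating polynomials of \<open>d\<close> and of \<open>d\<close> with one index deleted. The
  rank-one term carries a factor \<open>x\<close>, which lowers the degree from \<open>Suc j\<close>
  to \<open>j\<close>.\<close>

lemma sigma_add_outer:
  fixes Q :: "real^'n::finite^'n"
  assumes Q: "orthogonal_matrix Q"
  shows "sigma (Suc j) (Q ** diag_mat d ** transpose Q + outer (Q *v h))
    = esym UNIV d (Suc j) + (\<Sum>i\<in>UNIV. (h $ i)\<^sup>2 * esym (UNIV - {i}) d j)"
proof -
  let ?q = "(\<Prod>i\<in>UNIV. [:1, d i:]) + [:0, 1:] * (\<Sum>i\<in>UNIV. smult ((h $ i)\<^sup>2) (\<Prod>l\<in>UNIV - {i}. [:1, d l:]))"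
  let ?B = "Q ** (diag_mat d + outer h) ** transpose Q"
  have B: "Q ** diag_mat d ** transpose Q + outer (Q *v h) = ?B"
    by (simp add: matrix_algebra_simps conjugate_outer)
  have tr: "transpose (outer v) = outer v" for v :: "real^'n"
    by (simp add: outer_def transpose_def vec_eq_iff)
  have "sigma (Suc j) ?B = coeff ?q (Suc j)"
  proof (rule sigma_eq_coeff)
    have "transpose (X + Y) = transpose X + transpose Y" for X Y :: "real^'n^'n"
      by (simp add: transpose_def vec_eq_iff)
    then show "transpose ?B = ?B"
      unfolding B[symmetric] by (simp add: tr transpose_conjugate_diag)
    fix x
    have "mat 1 + x *\<^sub>R (diag_mat d + outer h) = (\<chi> i. (1 + x * d i) *\<^sub>R axis i 1 + (x * h $ i) *\<^sub>R h)"
      by (auto simp: vec_eq_iff mat_def diag_mat_def outer_def axis_def algebra_simps)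
    then have "det (mat 1 + x *\<^sub>R ?B) = det (\<chi> i. (1 + x * d i) *\<^sub>R axis i 1 + (x * h $ i) *\<^sub>R h)"
      by (simp add: orthogonal_conjugate_one_plus[OF Q] det_orthogonal_conjugate[OF Q])
    also have "\<dots> = poly ?q x"
      by (simp add: det_diag_plus_rank_one poly_prod poly_sum sum_distrib_left power2_eq_square mult_ac)
    finally show "poly ?q x = det (mat 1 + x *\<^sub>R ?B)" by simp
  qed
  also have "\<dots> = esym UNIV d (Suc j) + (\<Sum>i\<in>UNIV. (h $ i)\<^sup>2 * esym (UNIV - {i}) d j)"
    by (simp add: esym_def coeff_sum)
  finally show ?thesis by (simp add: B)
qed

text \<open>In eigen-coordinates \<open>transpose Q *v v\<close> the increment is a sum of squares
  times \<open>esym (UNIV - {i}) d (j - 1)\<close>, and these are positive by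
  \<open>esym_remove_pos\<close>.\<close>

lemma sigma_mono_outer:
  fixes A :: "real^'n::finite^'n"
  assumes A: "transpose A = A" and pos: "\<And>j. j \<in> {1..k} \<Longrightarrow> 0 < sigma j A" and j: "j \<in> {1..k}"
  shows "sigma j A \<le> sigma j (A + outer v)"
proof -
  obtain Q d where Q: "orthogonal_matrix Q" and A_eq: "A = Q ** diag_mat d ** transpose Q"
    using symmetric_diagonalizable[OF A] by blast
  have s: "sigma i A = esym UNIV d i" for i
    unfolding A_eq by (rule sigma_conjugate_diag[OF Q])
  have d: "0 < esym UNIV d i" if "i \<le> k" for i
    using pos[of i] that by (cases "i = 0") (auto simp: s)
  have v: "Q *v (transpose Q *v v) = v"
    using Q by (simp add: matrix_vector_mul_assoc orthogonal_matrix_def del: transpose_matrix_vector)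
  obtain m where m: "j = Suc m" "m < k"
    using j by (cases j) auto
  have "0 \<le> (\<Sum>i\<in>UNIV. ((transpose Q *v v) $ i)\<^sup>2 * esym (UNIV - {i}) d m)"
    using esym_remove_pos[of UNIV _ k d m] d m(2)
    by (intro sum_nonneg mult_nonneg_nonneg) (auto intro!: less_imp_le)
  then show ?thesis
    using sigma_add_outer[OF Q, of m d "transpose Q *v v"] by (simp only: v s m(1) A_eq[symmetric])
qed

text \<open>A nonnegative symmetric matrix is a sum of terms
  \<open>outer (sqrt (d i) *\<^sub>R column i Q)\<close>, added here one at a time. The induction
  carries all degrees up to \<open>k\<close>, since each rank-one step needs the current matrix to
  be in the cone of order \<open>k\<close>.\<close>

lemma sigma_mono:
  fixes A N :: "real^'n::finite^'n"
  assumes A: "transpose A = A" and pos: "\<And>j. j \<in> {1..k} \<Longrightarrow> 0 < sigma j A"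
    and N: "transpose N = N" "\<And>x. 0 \<le> x \<bullet> (N *v x)" and "1 \<le> k"
  shows "sigma k A \<le> sigma k (A + N)"
proof -
  obtain Q d where Q: "orthogonal_matrix Q" and N_eq: "N = Q ** diag_mat d ** transpose Q"
    using symmetric_diagonalizable[OF N(1)] by blast
  \<comment> \<open>Testing the quadratic form of \<open>N\<close> on the eigenvector
    \<open>Q *v axis i 1\<close> returns \<open>d i\<close>.\<close>
  have d: "0 \<le> d i" for i
  proof -
    have "transpose Q *v (Q *v axis i 1) = axis i 1"
      using Q by (simp add: matrix_vector_mul_assoc orthogonal_matrix_def del: transpose_matrix_vector)
    then have "N *v (Q *v axis i 1) = Q *v (diag_mat d *v axis i 1)"
      by (simp add: N_eq del: transpose_matrix_vector flip: matrix_vector_mul_assoc)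
    also have "(Q *v axis i 1) \<bullet> \<dots> = axis i 1 \<bullet> (diag_mat d *v axis i 1)"
      using \<open>transpose Q *v _ = _\<close> by (metis dot_lmul_matrix transpose_matrix_vector transpose_transpose)
    also have "\<dots> = d i"
      by (simp add: inner_axis' matrix_vector_mul_component inner_axis diag_mat_def)
    finally show ?thesis using N(2)[of "Q *v axis i 1"] by simp
  qed
  let ?w = "\<lambda>i. sqrt (d i) *\<^sub>R column i Q"
  have N_sum: "N = (\<Sum>i\<in>UNIV. outer (?w i))"
  proof -
    have "N $ r $ c = (\<Sum>i\<in>UNIV. outer (?w i)) $ r $ c" for r c
    proof -
      have "N $ r $ c = (\<Sum>i\<in>UNIV. Q $ r $ i * d i * Q $ c $ i)"
        by (simp add: N_eq matrix_matrix_mult_def diag_mat_def transpose_def if_distrib cong: if_cong)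
      also have "\<dots> = (\<Sum>i\<in>UNIV. outer (?w i) $ r $ c)"
      proof (intro sum.cong refl)
        fix i
        have "outer (?w i) $ r $ c = (sqrt (d i) * sqrt (d i)) * (Q $ r $ i * Q $ c $ i)"
          unfolding outer_def column_def by (simp only: vec_lambda_beta vector_scaleR_component real_scaleR_def mult_ac)
        then show "Q $ r $ i * d i * Q $ c $ i = outer (?w i) $ r $ c" using d by simp
      qed
      finally show ?thesis by simp
    qed
    then show ?thesis by (simp add: vec_eq_iff)
  qed
  have tr: "transpose (X + outer v) = X + outer v" if "transpose X = X" for X :: "real^'n^'n" and v
    using that by (simp add: outer_def transpose_def vec_eq_iff mult.commute)
  have "transpose (A + (\<Sum>i\<in>S. outer (?w i))) = A + (\<Sum>i\<in>S. outer (?w i)) \<and>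
    (\<forall>j\<in>{1..k}. sigma j A \<le> sigma j (A + (\<Sum>i\<in>S. outer (?w i))))" if "finite S" for S
    using that
  proof (induction S)
    case (insert i S)
    let ?B = "A + (\<Sum>i\<in>S. outer (?w i))"
    have B: "A + (\<Sum>i\<in>insert i S. outer (?w i)) = ?B + outer (?w i)"
      using insert by (simp add: algebra_simps)
    have "sigma j A \<le> sigma j (?B + outer (?w i))" if "j \<in> {1..k}" for j
    proof -
      have "sigma j ?B \<le> sigma j (?B + outer (?w i))"
      proof (rule sigma_mono_outer[OF _ _ that])
        show "transpose ?B = ?B" using insert.IH by blast
        show "0 < sigma i ?B" if "i \<in> {1..k}" for i
          using insert.IH pos[OF that] that by (meson less_le_trans)
      qed
      then show ?thesis using insert that by fastforce
    qed
    then show ?case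
      unfolding B using insert tr by blast
  qed (use A in simp)
  from this[of UNIV] show ?thesis
    using \<open>1 \<le> k\<close> by (simp add: N_sum)
qed

section \<open>Perturbation of determinants\<close>

text \<open>First-order Taylor expansion of a product whose remainder constant depends only on
  \<open>B\<close> and the number of factors.\<close>

lemma prod_perturbation:
  fixes B :: real
  assumes "finite S"
  shows "\<exists>C\<ge>0. \<forall>\<delta>\<in>{0..1}. \<forall>x m. (\<forall>i\<in>S. \<bar>x i\<bar> \<le> B \<and> \<bar>m i\<bar> \<le> B) \<longrightarrow>
    \<bar>(\<Prod>i\<in>S. x i + \<delta> * m i) - (\<Prod>i\<in>S. x i) - \<delta> * (\<Sum>i\<in>S. m i * (\<Prod>l\<in>S - {i}. x l))\<bar> \<le> C * \<delta>\<^sup>2"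
  using assms
proof (induction S)
  case empty
  show ?case by (intro exI[of _ 0]) simp
next
  case (insert a S)
  let ?E = "\<lambda>S \<delta> x m. (\<Prod>i\<in>S. x i + \<delta> * m i) - (\<Prod>i\<in>S. x i) - \<delta> * (\<Sum>i\<in>S. m i * (\<Prod>l\<in>S - {i}. x l))"
  let ?D = "\<lambda>S x m. \<Sum>i\<in>S. m i * (\<Prod>l\<in>S - {i}. x l)"
  obtain C where C: "C \<ge> 0" and IH: "\<And>\<delta> x m. \<delta> \<in> {0..1} \<Longrightarrow> (\<And>i. i \<in> S \<Longrightarrow> \<bar>x i\<bar> \<le> B \<and> \<bar>m i\<bar> \<le> B) \<Longrightarrow> \<bar>?E S \<delta> x m\<bar> \<le> C * \<delta>\<^sup>2"
    using insert.IH by blast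
  \<comment> \<open>Bounds the first-order sum: \<open>card S\<close> summands, each a product of
    \<open>card S\<close> factors of size at most \<open>B\<close>.\<close>
  define D where "D = real (card S) * (B * B ^ (card S - 1))"
  show ?case
  proof (intro exI[of _ "\<bar>B\<bar> * \<bar>D\<bar> + 2 * \<bar>B\<bar> * C"] conjI ballI allI impI)
    fix \<delta> x m
    assume \<delta>: "\<delta> \<in> {0..1::real}" and *: "\<forall>i\<in>insert a S. \<bar>x i\<bar> \<le> B \<and> \<bar>m i\<bar> \<le> B"
    have B: "0 \<le> B" using * by force
    have "\<bar>?D S x m\<bar> \<le> (\<Sum>i\<in>S. \<bar>m i * (\<Prod>l\<in>S - {i}. x l)\<bar>)" by (rule sum_abs)
    also have "\<dots> \<le> (\<Sum>i\<in>S. B * B ^ (card S - 1))"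
    proof (rule sum_mono)
      fix i assume i: "i \<in> S"
      have "\<bar>\<Prod>l\<in>S - {i}. x l\<bar> \<le> (\<Prod>l\<in>S - {i}. B)"
        unfolding abs_prod by (rule prod_mono) (use * in auto)
      then show "\<bar>m i * (\<Prod>l\<in>S - {i}. x l)\<bar> \<le> B * B ^ (card S - 1)"
        unfolding abs_mult using i insert.hyps * B by (intro mult_mono) auto
    qed
    also have "\<dots> = D" by (simp add: D_def)
    finally have D: "\<bar>?D S x m\<bar> \<le> \<bar>D\<bar>" by simp
    have sum_eq: "?D (insert a S) x m = m a * (\<Prod>l\<in>S. x l) + x a * ?D S x m"
    proof -
      have "(\<Sum>i\<in>S. m i * (\<Prod>l\<in>insert a S - {i}. x l)) = (\<Sum>i\<in>S. x a * (m i * (\<Prod>l\<in>S - {i}. x l)))"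
      proof (intro sum.cong refl)
        fix i assume "i \<in> S"
        then have "insert a S - {i} = insert a (S - {i})" using insert.hyps by auto
        then show "m i * (\<Prod>l\<in>insert a S - {i}. x l) = x a * (m i * (\<Prod>l\<in>S - {i}. x l))"
          using insert.hyps by simp
      qed
      then show ?thesis using insert.hyps by (simp add: sum_distrib_left)
    qed
    \<comment> \<open>The recursion for the remainder. The first term is already of second order,
      and in the second the new factor is at most \<open>2 * B\<close> because
      \<open>\<delta> \<le> 1\<close>; this gives the two parts of the constant.\<close>
    have eq: "?E (insert a S) \<delta> x m = \<delta>\<^sup>2 * (m a * ?D S x m) + (x a + \<delta> * m a) * ?E S \<delta> x m"
      unfolding sum_eq using insert.hyps by (simp add: algebra_simps power2_eq_square)
    have "\<bar>?E (insert a S) \<delta> x m\<bar> \<le> \<bar>\<delta>\<^sup>2 * (m a * ?D S x m)\<bar> + \<bar>(x a + \<delta> * m a) * ?E S \<delta> x m\<bar>"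
      unfolding eq by (rule abs_triangle_ineq)
    also have "\<bar>\<delta>\<^sup>2 * (m a * ?D S x m)\<bar> \<le> \<delta>\<^sup>2 * (\<bar>B\<bar> * \<bar>D\<bar>)"
      unfolding abs_mult using D * by (intro mult_mono) auto
    also have "\<bar>(x a + \<delta> * m a) * ?E S \<delta> x m\<bar> \<le> (2 * \<bar>B\<bar>) * (C * \<delta>\<^sup>2)"
    proof -
      have "\<bar>\<delta> * m a\<bar> \<le> 1 * B" unfolding abs_mult using \<delta> * by (intro mult_mono) auto
      moreover have "\<bar>x a\<bar> \<le> B" using * by simp
      ultimately have "\<bar>x a + \<delta> * m a\<bar> \<le> 2 * \<bar>B\<bar>" using B by linarith
      moreover have "\<bar>?E S \<delta> x m\<bar> \<le> C * \<delta>\<^sup>2"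
        by (rule IH[OF \<delta>]) (use * in auto)
      ultimately show ?thesis unfolding abs_mult by (rule mult_mono) auto
    qed
    finally show "\<bar>?E (insert a S) \<delta> x m\<bar> \<le> (\<bar>B\<bar> * \<bar>D\<bar> + 2 * \<bar>B\<bar> * C) * \<delta>\<^sup>2"
      by (simp add: algebra_simps)
  qed (use C in auto)
qed

text \<open>A permutation other than the identity moves at least two indices, so its term in the Leibniz
  formula is of second order in the off-diagonal entries.\<close>

lemma det_perturbation:
  fixes B :: real
  shows "\<exists>C\<ge>0. \<forall>\<delta>\<in>{0..1}. \<forall>x. \<forall>M :: real^'n::finite^'n. (\<forall>i. \<bar>x i\<bar> \<le> B) \<and> (\<forall>i j. \<bar>M $ i $ j\<bar> \<le> B) \<longrightarrow>
    \<bar>det (diag_mat x + \<delta> *\<^sub>R M) - (\<Prod>i\<in>UNIV. x i)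
       - \<delta> * (\<Sum>i\<in>UNIV. M $ i $ i * (\<Prod>l\<in>UNIV - {i}. x l))\<bar> \<le> C * \<delta>\<^sup>2"
proof -
  obtain C where C: "C \<ge> 0" and E: "\<And>\<delta> (x :: 'n \<Rightarrow> real) m. \<delta> \<in> {0..1} \<Longrightarrow> (\<And>i. \<bar>x i\<bar> \<le> B \<and> \<bar>m i\<bar> \<le> B) \<Longrightarrow>
     \<bar>(\<Prod>i\<in>UNIV. x i + \<delta> * m i) - (\<Prod>i\<in>UNIV. x i) - \<delta> * (\<Sum>i\<in>UNIV. m i * (\<Prod>l\<in>UNIV - {i}. x l))\<bar> \<le> C * \<delta>\<^sup>2"
    using prod_perturbation[of "UNIV :: 'n set" B] by auto
  define K where "K = card {p. p permutes (UNIV :: 'n set)}"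
  show ?thesis
  proof (intro exI[of _ "K * C"] conjI ballI allI impI)
    fix \<delta> :: real and x :: "'n \<Rightarrow> real" and M :: "real^'n^'n"
    assume \<delta>: "\<delta> \<in> {0..1}" and *: "(\<forall>i. \<bar>x i\<bar> \<le> B) \<and> (\<forall>i j. \<bar>M $ i $ j\<bar> \<le> B)"
    let ?A = "diag_mat x + \<delta> *\<^sub>R M"
    let ?L = "(\<Prod>i\<in>UNIV. x i) + \<delta> * (\<Sum>i\<in>UNIV. M $ i $ i * (\<Prod>l\<in>UNIV - {i}. x l))"
    let ?perms = "{p. p permutes (UNIV :: 'n set)}"
    have B: "0 \<le> B" using * by (meson abs_ge_zero order_trans)
    have tm: "\<bar>of_int (sign p) * (\<Prod>i\<in>UNIV. ?A $ i $ p i) - (if p = id then ?L else 0)\<bar> \<le> C * \<delta>\<^sup>2"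
      if p: "p permutes UNIV" for p
    proof (cases "p = id")
      case True
      then show ?thesis
        using E[OF \<delta>, of x "\<lambda>i. M $ i $ i"] * by (simp add: diag_mat_def sign_id algebra_simps)
    next
      case False
      \<comment> \<open>With the diagonal entry kept only at fixed points of \<open>p\<close>, the
        factor in row \<open>i\<close> is again \<open>?x i + \<delta> * M $ i $ p i\<close>, so the
        product estimate applies to every permutation.\<close>
      let ?x = "\<lambda>i. if p i = i then x i else 0"
      obtain a where a: "p a \<noteq> a" using False by (metis eq_id_iff)
      have b: "p (p a) \<noteq> p a" using a permutes_inj[OF p] by (metis injD)
      \<comment> \<open>Both \<open>a\<close> and \<open>p a\<close> are moved by \<open>p\<close>
        and they differ, so a zero factor survives even after one index is omitted; the terms of
        order zero and one vanish.\<close>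
      have 0: "(\<Prod>i\<in>UNIV. ?x i) = 0" "(\<Prod>l\<in>UNIV - {i}. ?x l) = 0" for i
        by (intro prod_zero; use a in auto) (intro prod_zero; use a b in \<open>cases "i = a"; auto\<close>)
      have "(\<Prod>i\<in>UNIV. ?A $ i $ p i) = (\<Prod>i\<in>UNIV. ?x i + \<delta> * M $ i $ p i)"
        by (intro prod.cong) (auto simp: diag_mat_def)
      moreover have "\<bar>(\<Prod>i\<in>UNIV. ?x i + \<delta> * M $ i $ p i) - (\<Prod>i\<in>UNIV. ?x i)
          - \<delta> * (\<Sum>i\<in>UNIV. M $ i $ p i * (\<Prod>l\<in>UNIV - {i}. ?x l))\<bar> \<le> C * \<delta>\<^sup>2"
        using E[OF \<delta>, of ?x "\<lambda>i. M $ i $ p i"] * B by auto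
      ultimately have "\<bar>\<Prod>i\<in>UNIV. ?A $ i $ p i\<bar> \<le> C * \<delta>\<^sup>2"
        by (simp add: 0)
      then show ?thesis using False by (simp add: abs_mult sign_def)
    qed
    have "det ?A - ?L = (\<Sum>p\<in>?perms. of_int (sign p) * (\<Prod>i\<in>UNIV. ?A $ i $ p i)) - (\<Sum>p\<in>?perms. if p = id then ?L else 0)"
      unfolding det_def by (subst sum.delta) (auto simp: permutes_id)
    also have "\<bar>\<dots>\<bar> \<le> (\<Sum>p\<in>?perms. C * \<delta>\<^sup>2)"
      unfolding sum_subtractf[symmetric] using tm by (intro order_trans[OF sum_abs] sum_mono) auto
    also have "\<dots> = K * C * \<delta>\<^sup>2" by (simp add: K_def)
    finally show "\<bar>det ?A - (\<Prod>i\<in>UNIV. x i) - \<delta> * (\<Sum>i\<in>UNIV. M $ i $ i * (\<Prod>l\<in>UNIV - {i}. x l))\<bar> \<le> K * C * \<delta>\<^sup>2"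
      by (simp add: algebra_simps)
  qed (use C in auto)
qed

text \<open>A quantitative form of interpolation at the nodes \<open>0, ..., n\<close>, with a
  constant independent of the polynomial. Division by \<open>X - (n + 1)\<close> lowers the degree,
  and at the remaining nodes the divisor has absolute value at least 1, so the quotient is bounded
  there by \<open>2 * B\<close>.\<close>

lemma coeff_bounded_by_values:
  "\<exists>C\<ge>0. \<forall>p :: real poly. \<forall>B. degree p \<le> n \<and> (\<forall>m\<le>n. \<bar>poly p (real m)\<bar> \<le> B) \<longrightarrow> \<bar>coeff p j\<bar> \<le> C * B"
proof (induction n arbitrary: j)
  case 0
  show ?case
  proof (intro exI[of _ 1] conjI allI impI)
    fix p :: "real poly" and B
    assume *: "degree p \<le> 0 \<and> (\<forall>m\<le>0. \<bar>poly p (real m)\<bar> \<le> B)"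
    then obtain c where "p = [:c:]" by (auto elim: degree_eq_zeroE)
    then show "\<bar>coeff p j\<bar> \<le> 1 * B" using * by (cases j) auto
  qed simp
next
  case (Suc n)
  obtain C where C: "\<And>j. C j \<ge> 0" "\<And>j p B. degree p \<le> n \<Longrightarrow> (\<And>m. m \<le> n \<Longrightarrow> \<bar>poly p (real m)\<bar> \<le> B) \<Longrightarrow> \<bar>coeff p j\<bar> \<le> C j * B"
    using Suc.IH by metis
  let ?a = "real (Suc n)"
  \<comment> \<open>The constant follows
    \<open>coeff p j = coeff q (j - 1) - ?a * coeff q j\<close>, plus 1 for the value at the last
    node, which replaces the first term when \<open>j = 0\<close>. In that case the truncated
    \<open>j - 1\<close> only adds a nonnegative amount.\<close>
  show ?case
  proof (intro exI[of _ "2 * (C (j - 1) + ?a * C j) + 1"] conjI allI impI)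
    fix p :: "real poly" and B
    assume *: "degree p \<le> Suc n \<and> (\<forall>m\<le>Suc n. \<bar>poly p (real m)\<bar> \<le> B)"
    then have bnd: "\<bar>poly p (real m)\<bar> \<le> B" if "m \<le> Suc n" for m using that by blast
    from bnd[of 0] have B: "0 \<le> B" by simp
    define q where "q = synthetic_div p ?a"
    have p: "p = [:- ?a, 1:] * q + [:poly p ?a:]"
      using synthetic_div_correct'[of ?a p] by (simp add: q_def)
    have q: "\<bar>coeff q i\<bar> \<le> C i * (2 * B)" for i
    proof (rule C(2))
      show "degree q \<le> n" using * degree_synthetic_div[of p ?a] unfolding q_def by linarith
      fix m assume m: "m \<le> n"
      have "poly p (real m) = (real m - ?a) * poly q (real m) + poly p ?a"
        by (subst p) (simp add: algebra_simps)
      then have "\<bar>(real m - ?a) * poly q (real m)\<bar> \<le> 2 * B"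
        using bnd[of m] bnd[of "Suc n"] m by linarith
      moreover have "1 * \<bar>poly q (real m)\<bar> \<le> \<bar>real m - ?a\<bar> * \<bar>poly q (real m)\<bar>"
        using m by (intro mult_right_mono) auto
      ultimately show "\<bar>poly q (real m)\<bar> \<le> 2 * B" by (simp add: abs_mult)
    qed
    have pa: "\<bar>poly p ?a\<bar> \<le> B" using bnd by blast
    have "\<bar>?a * coeff q j\<bar> \<le> ?a * (C j * (2 * B))"
      unfolding abs_mult using q[of j] by (intro mult_mono) auto
    moreover have "coeff p j = (if j = 0 then poly p ?a else coeff q (j - 1)) - ?a * coeff q j"
      by (subst p) (cases j; simp add: algebra_simps)
    moreover have "\<bar>if j = 0 then poly p ?a else coeff q (j - 1)\<bar> \<le> C (j - 1) * (2 * B) + B"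
    proof -
      have "0 \<le> C (j - 1) * (2 * B)" using C(1) B by simp
      then show ?thesis
        using q[of "j - 1"] pa B by (cases "j = 0") (simp_all del: of_nat_Suc)
    qed
    ultimately have "\<bar>coeff p j\<bar> \<le> C (j - 1) * (2 * B) + ?a * (C j * (2 * B)) + B"
      by linarith
    then show "\<bar>coeff p j\<bar> \<le> (2 * (C (j - 1) + ?a * C j) + 1) * B"
      by (simp add: algebra_simps)
  qed (use C(1) in simp)
qed

lemma degree_prod_linear_le:
  fixes l :: "'a \<Rightarrow> real"
  assumes "finite S"
  shows "degree (\<Prod>i\<in>S. [:1, l i:]) \<le> card S"
  using assms
proof (induction S)
  case (insert x S)
  have "degree ([:1, l x:] * (\<Prod>i\<in>S. [:1, l i:])) \<le> degree [:1, l x:] + degree (\<Prod>i\<in>S. [:1, l i:])"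
    by (rule degree_mult_le)
  also have "\<dots> \<le> 1 + card S"
    using insert.IH by (intro add_mono) auto
  finally show ?case using insert.hyps by simp
qed simp

text \<open>First-order expansion of \<open>sigma (Suc j)\<close> at a diagonalised matrix. It holds
  at each node for the determinant of \<open>mat 1 + x *\<^sub>R A\<close>, uniformly in
  \<open>M\<close>, and is transferred to the coefficient by
  \<open>coeff_bounded_by_values\<close>.\<close>

lemma sigma_perturbation:
  fixes Q :: "real^'n::finite^'n"
  assumes Q: "orthogonal_matrix Q"
  shows "\<exists>C\<ge>0. \<forall>\<delta>\<in>{0..1}. \<forall>M. transpose M = M \<and> (\<forall>i j. \<bar>M $ i $ j\<bar> \<le> B) \<longrightarrow>
    \<bar>sigma (Suc j) (Q ** diag_mat d ** transpose Q + \<delta> *\<^sub>R M) - esym UNIV d (Suc j)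
      - \<delta> * (\<Sum>i\<in>UNIV. (transpose Q ** M ** Q) $ i $ i * esym (UNIV - {i}) d j)\<bar> \<le> C * \<delta>\<^sup>2"
proof -
  let ?n = "CARD('n)"
  define b where "b = (\<Sum>i\<in>UNIV. \<Sum>l\<in>UNIV. \<bar>Q $ i $ l\<bar>)"
  have Qb: "\<bar>Q $ i $ l\<bar> \<le> b" for i l
    unfolding b_def
    by (rule order_trans[OF member_le_sum[of l UNIV "\<lambda>l. \<bar>Q $ i $ l\<bar>"]], auto)
      (rule member_le_sum[of i UNIV "\<lambda>i. \<Sum>l\<in>UNIV. \<bar>Q $ i $ l\<bar>"], auto intro: sum_nonneg)
  have b0: "0 \<le> b" using Qb abs_ge_zero order_trans by blast
  \<comment> \<open>Dominates both inputs of \<open>det_perturbation\<close> at every node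
    \<open>m \<le> CARD('n)\<close>: the diagonal entries \<open>1 + m * d i\<close>, and the
    entries of \<open>m *\<^sub>R N\<close>, where rotating \<open>M\<close> by \<open>Q\<close>
    costs the dimension squared times \<open>b * b\<close>.\<close>
  define B' where "B' = max (1 + ?n * (\<Sum>i\<in>UNIV. \<bar>d i\<bar>)) (?n * (?n * (?n * (b * \<bar>B\<bar> * b))))"
  obtain C1 where C1: "C1 \<ge> 0" and det: "\<forall>\<delta>\<in>{0..1}. \<forall>x. \<forall>M :: real^'n^'n.
    (\<forall>i. \<bar>x i\<bar> \<le> B') \<and> (\<forall>i j. \<bar>M $ i $ j\<bar> \<le> B') \<longrightarrow>
    \<bar>det (diag_mat x + \<delta> *\<^sub>R M) - (\<Prod>i\<in>UNIV. x i)
       - \<delta> * (\<Sum>i\<in>UNIV. M $ i $ i * (\<Prod>l\<in>UNIV - {i}. x l))\<bar> \<le> C1 * \<delta>\<^sup>2"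
    using det_perturbation[of B'] by (elim exE conjE)
  obtain C2 where C2: "C2 \<ge> 0" and cf: "\<And>(p :: real poly) B. degree p \<le> ?n \<Longrightarrow> (\<And>m. m \<le> ?n \<Longrightarrow> \<bar>poly p (real m)\<bar> \<le> B) \<Longrightarrow> \<bar>coeff p (Suc j)\<bar> \<le> C2 * B"
    using coeff_bounded_by_values[of ?n "Suc j"] by auto
  show ?thesis
  proof (intro exI[of _ "C2 * C1"] conjI ballI allI impI)
    fix \<delta> :: real and M :: "real^'n^'n"
    assume \<delta>: "\<delta> \<in> {0..1}" and M: "transpose M = M \<and> (\<forall>i j. \<bar>M $ i $ j\<bar> \<le> B)"
    let ?A = "Q ** diag_mat d ** transpose Q + \<delta> *\<^sub>R M"
    define N where "N = transpose Q ** M ** Q"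
    have Nb: "\<bar>N $ i $ l\<bar> \<le> ?n * (?n * (b * \<bar>B\<bar> * b))" for i l
    proof -
      have "\<bar>N $ i $ l\<bar> \<le> (\<Sum>r\<in>UNIV. \<Sum>s\<in>UNIV. \<bar>Q $ s $ i * M $ s $ r * Q $ r $ l\<bar>)"
        unfolding N_def matrix_matrix_mult_def
        by (simp add: transpose_def sum_distrib_right)
          (rule order_trans[OF sum_abs], rule sum_mono, rule sum_abs)
      also have "\<dots> \<le> (\<Sum>r\<in>(UNIV::'n set). \<Sum>s\<in>(UNIV::'n set). b * \<bar>B\<bar> * b)"
        unfolding abs_mult using Qb M b0 by (intro sum_mono mult_mono) (auto intro: order_trans[OF _ abs_ge_self])
      finally show ?thesis by simp
    qed
    have A: "?A = Q ** (diag_mat d + \<delta> *\<^sub>R N) ** transpose Q"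
    proof -
      have "Q ** N ** transpose Q = (Q ** transpose Q) ** M ** (Q ** transpose Q)"
        by (simp add: N_def matrix_mul_assoc)
      then have "Q ** N ** transpose Q = M"
        using Q by (simp add: orthogonal_matrix_def)
      then show ?thesis by (simp add: matrix_algebra_simps)
    qed
    have tr: "transpose ?A = ?A"
      using transpose_conjugate_diag[of Q d] M
      by (simp add: transpose_def vec_eq_iff)
    let ?p = "\<Prod>i\<in>UNIV. [:1, eigenvalues ?A $ i:]"
    let ?q = "(\<Prod>i\<in>UNIV. [:1, d i:])"
    \<comment> \<open>The candidate derivative of the generating polynomial in the direction
      \<open>N\<close>; only diagonal entries of the rotated perturbation enter.\<close>
    let ?r = "[:0, 1:] * (\<Sum>i\<in>UNIV. smult (N $ i $ i) (\<Prod>l\<in>UNIV - {i}. [:1, d l:]))"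
    have "\<bar>coeff (?p - ?q - smult \<delta> ?r) (Suc j)\<bar> \<le> C2 * (C1 * \<delta>\<^sup>2)"
    proof (rule cf)
      have "degree (\<Prod>l\<in>UNIV - {i}. [:1, d l:]) \<le> ?n - 1" for i :: 'n
        using degree_prod_linear_le[of "UNIV - {i}" d] by simp
      then have "degree (\<Sum>i\<in>UNIV. smult (N $ i $ i) (\<Prod>l\<in>UNIV - {i}. [:1, d l:])) \<le> ?n - 1"
        by (intro degree_sum_le) (auto intro: order_trans[OF degree_smult_le])
      moreover have "degree ?r \<le> degree [:0, 1 :: real:]
          + degree (\<Sum>i\<in>UNIV. smult (N $ i $ i) (\<Prod>l\<in>UNIV - {i}. [:1, d l:]))"
        by (rule degree_mult_le)
      moreover have "degree [:0, 1 :: real:] = 1" by simp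
      moreover have "0 < ?n" by simp
      ultimately have "degree ?r \<le> ?n" by linarith
      then show "degree (?p - ?q - smult \<delta> ?r) \<le> ?n"
        by (intro degree_diff_le degree_prod_linear_le order_trans[OF degree_smult_le]) auto
      fix m :: nat assume m: "m \<le> ?n"
      let ?x = "real m"
      have "mat 1 + ?x *\<^sub>R ?A = Q ** (diag_mat (\<lambda>i. 1 + ?x * d i) + \<delta> *\<^sub>R (?x *\<^sub>R N)) ** transpose Q"
        unfolding A orthogonal_conjugate_one_plus[OF Q]
        by (intro arg_cong[of _ _ "\<lambda>X. Q ** X ** transpose Q"])
          (auto simp: vec_eq_iff mat_def diag_mat_def algebra_simps)
      then have *: "poly ?p ?x = det (diag_mat (\<lambda>i. 1 + ?x * d i) + \<delta> *\<^sub>R (?x *\<^sub>R N))"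
        using det_one_plus_eigenvalues[OF tr, of ?x] by (simp add: poly_prod det_orthogonal_conjugate[OF Q])
      have "\<bar>det (diag_mat (\<lambda>i. 1 + ?x * d i) + \<delta> *\<^sub>R (?x *\<^sub>R N)) - (\<Prod>i\<in>UNIV. 1 + ?x * d i)
        - \<delta> * (\<Sum>i\<in>UNIV. (?x *\<^sub>R N) $ i $ i * (\<Prod>l\<in>UNIV - {i}. 1 + ?x * d l))\<bar> \<le> C1 * \<delta>\<^sup>2"
      proof (rule det[rule_format, OF \<delta>], intro conjI allI)
        fix i :: 'n
        have "\<bar>?x * d i\<bar> \<le> ?n * (\<Sum>i\<in>UNIV. \<bar>d i\<bar>)"
          unfolding abs_mult using m member_le_sum[of i UNIV "\<lambda>i. \<bar>d i\<bar>"] by (intro mult_mono) auto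
        then show "\<bar>1 + ?x * d i\<bar> \<le> B'" by (simp add: B'_def)
      next
        fix i l :: 'n
        have "\<bar>?x * N $ i $ l\<bar> \<le> ?n * (?n * (?n * (b * \<bar>B\<bar> * b)))"
          unfolding abs_mult using m Nb[of i l] by (intro mult_mono) auto
        then show "\<bar>(?x *\<^sub>R N) $ i $ l\<bar> \<le> B'" by (simp add: B'_def)
      qed
      moreover have "poly ?q ?x = (\<Prod>i\<in>UNIV. 1 + ?x * d i)"
        by (simp add: poly_prod)
      moreover have "poly ?r ?x = (\<Sum>i\<in>UNIV. (?x *\<^sub>R N) $ i $ i * (\<Prod>l\<in>UNIV - {i}. 1 + ?x * d l))"
        by (simp add: poly_prod poly_sum sum_distrib_left mult_ac)
      ultimately show "\<bar>poly (?p - ?q - smult \<delta> ?r) ?x\<bar> \<le> C1 * \<delta>\<^sup>2"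
        by (simp only: * poly_diff poly_smult)
    qed
    moreover have "coeff ?p (Suc j) = sigma (Suc j) ?A"
      by (simp add: sigma_def elem_sym_eq_esym esym_def)
    ultimately show "\<bar>sigma (Suc j) ?A - esym UNIV d (Suc j)
      - \<delta> * (\<Sum>i\<in>UNIV. (transpose Q ** M ** Q) $ i $ i * esym (UNIV - {i}) d j)\<bar> \<le> C2 * C1 * \<delta>\<^sup>2"
      by (simp add: esym_def coeff_sum N_def mult.assoc)
  qed (use C1 C2 in simp)
qed

section \<open>Orthogonal projections\<close>

lemma orth_proj_eqI:
  assumes "subspace E" "y \<in> E" "x - y \<in> E\<^sup>\<bottom>"
  shows "orth_proj E x = y"
  unfolding orth_proj_def
proof (rule the_equality)
  fix z assume z: "z \<in> E \<and> x - z \<in> E\<^sup>\<bottom>"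
  have "(x - y) - (x - z) \<in> E\<^sup>\<bottom>" "z - y \<in> E"
    using assms z by (blast intro: subspace_diff subspace_orthogonal_comp)+
  then have "(z - y) \<bullet> (z - y) = 0"
    by (simp add: orthogonal_comp_def orthogonal_def)
  then show "z = y" by simp
qed (use assms in auto)

lemma orth_proj_in:
  assumes "subspace E"
  shows "orth_proj E x \<in> E" "x - orth_proj E x \<in> E\<^sup>\<bottom>"
proof -
  obtain y z where "y \<in> span E" "\<And>w. w \<in> span E \<Longrightarrow> orthogonal z w" "x = y + z"
    using orthogonal_subspace_decomp_exists[of E x] by blast
  then have "y \<in> E" "x - y \<in> E\<^sup>\<bottom>"
    using assms by (simp_all add: span_eq_iff[THEN iffD2] orthogonal_comp_def orthogonal_commute)
  then show "orth_proj E x \<in> E" "x - orth_proj E x \<in> E\<^sup>\<bottom>"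
    using orth_proj_eqI[OF assms] by auto
qed

lemma linear_orth_proj:
  fixes E :: "(real^'n::finite) set"
  assumes "subspace E"
  shows "linear (orth_proj E)"
proof (rule linearI)
  fix x y :: "real^'n" and c :: real
  have "x + y - (orth_proj E x + orth_proj E y) = (x - orth_proj E x) + (y - orth_proj E y)"
    by simp
  also have "\<dots> \<in> E\<^sup>\<bottom>"
    using assms orth_proj_in by (intro subspace_add subspace_orthogonal_comp) auto
  finally show "orth_proj E (x + y) = orth_proj E x + orth_proj E y"
    using assms orth_proj_in by (intro orth_proj_eqI subspace_add) auto
  have "c *\<^sub>R x - c *\<^sub>R orth_proj E x = c *\<^sub>R (x - orth_proj E x)"
    by (simp add: algebra_simps)
  also have "\<dots> \<in> E\<^sup>\<bottom>"
    using assms orth_proj_in by (intro subspace_scale subspace_orthogonal_comp) auto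
  finally show "orth_proj E (c *\<^sub>R x) = c *\<^sub>R orth_proj E x"
    using assms orth_proj_in by (intro orth_proj_eqI subspace_scale) auto
qed

lemma matrix_orth_proj_mult: "subspace E \<Longrightarrow> matrix (orth_proj E) *v x = orth_proj E x"
  by (simp add: linear_orth_proj matrix_works linear_matrix_vector_mul_eq)

lemma orth_proj_inner:
  assumes "subspace E"
  shows "orth_proj E x \<bullet> y = orth_proj E x \<bullet> orth_proj E y"
  using orth_proj_in[OF assms, of x] orth_proj_in[OF assms, of y]
  by (simp add: orthogonal_comp_def orthogonal_def inner_diff_right)

lemma transpose_orth_proj:
  assumes "subspace E"
  shows "transpose (matrix (orth_proj E)) = matrix (orth_proj E)"
proof -
  have "orth_proj E (axis i 1) $ j = orth_proj E (axis j 1) $ i" for i j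
    using orth_proj_inner[OF assms, of "axis i 1" "axis j 1"] orth_proj_inner[OF assms, of "axis j 1" "axis i 1"]
    by (simp add: inner_axis inner_commute[of "orth_proj E (axis j 1)" "orth_proj E (axis i 1)"])
  then show ?thesis
    by (simp add: matrix_def transpose_def vec_eq_iff)
qed

lemma orth_proj_orthogonal_comp:
  assumes "subspace E"
  shows "orth_proj (E\<^sup>\<bottom>) x = x - orth_proj E x"
proof (rule orth_proj_eqI[OF subspace_orthogonal_comp])
  show "x - (x - orth_proj E x) \<in> E\<^sup>\<bottom>\<^sup>\<bottom>"
    using orth_proj_in[OF assms] orthogonal_comp_subset by auto
qed (use orth_proj_in[OF assms] in auto)

lemma matrix_orth_proj_orthogonal_comp:
  assumes "subspace E"
  shows "matrix (orth_proj (E\<^sup>\<bottom>)) = mat 1 - matrix (orth_proj E)"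
  by (simp add: matrix_def orth_proj_orthogonal_comp[OF assms] vec_eq_iff mat_def axis_def)

text \<open>Idempotence forces the eigenvalues into \<open>{0, 1}\<close>. Membership in
  \<open>E\<close> means being fixed by the projection, so \<open>E\<close> is the rotated
  coordinate subspace belonging to eigenvalue 1, and its dimension counts the ones.\<close>

lemma orth_proj_diagonalization:
  fixes E :: "(real^'n::finite) set"
  assumes E: "subspace E"
  obtains Q d where "orthogonal_matrix Q" "matrix (orth_proj E) = Q ** diag_mat d ** transpose Q"
    "\<And>i. d i = 0 \<or> d i = 1" "card {i. d i = 1} = dim E"
proof -
  let ?P = "matrix (orth_proj E)"
  obtain Q d where Q: "orthogonal_matrix Q" and P: "?P = Q ** diag_mat d ** transpose Q"
    using symmetric_diagonalizable[OF transpose_orth_proj[OF E]] by blast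
  have QQ: "transpose Q ** Q = mat 1" "Q ** transpose Q = mat 1"
    using Q by (auto simp: orthogonal_matrix_def)
  have PQ: "orth_proj E (Q *v y) = Q *v (\<chi> i. d i * y $ i)" for y
  proof -
    have "orth_proj E (Q *v y) = (?P ** Q) *v y"
      using matrix_orth_proj_mult[OF E] by (simp add: matrix_vector_mul_assoc[symmetric])
    also have "?P ** Q = Q ** diag_mat d"
      unfolding P using QQ by (simp add: matrix_mul_assoc[symmetric])
    also have "(Q ** diag_mat d) *v y = Q *v (diag_mat d *v y)"
      by (simp add: matrix_vector_mul_assoc)
    also have "diag_mat d *v y = (\<chi> i. d i * y $ i)"
      by (simp add: vec_eq_iff diag_mat_def matrix_vector_mult_def if_distrib[of "\<lambda>x. x * _"] cong: if_cong)
    finally show ?thesis .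
  qed
  have inj: "inj ((*v) Q)"
    by (metis QQ(1) injI matrix_vector_mul_assoc matrix_vector_mul_lid)
  have fixed: "orth_proj E x = x \<longleftrightarrow> x \<in> E" for x
    using orth_proj_in(1)[OF E, of x] orth_proj_eqI[OF E, of x x] subspace_0[OF subspace_orthogonal_comp[of E]]
    by auto
  have d: "d i = 0 \<or> d i = 1" for i
  proof -
    have "orth_proj E (orth_proj E (Q *v axis i 1)) = orth_proj E (Q *v axis i 1)"
      using fixed orth_proj_in(1)[OF E] by blast
    then have "(\<chi> l. d l * (\<chi> l. d l * axis i 1 $ l) $ l) = (\<chi> l. d l * axis i 1 $ l)"
      unfolding PQ by (rule injD[OF inj])
    then have "d i * d i = d i" by (auto simp: vec_eq_iff axis_def split: if_splits)
    then show ?thesis by simp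
  qed
  have "E = (*v) Q ` {y. \<forall>i. i \<notin> {i. d i = 1} \<longrightarrow> y $ i = 0}" (is "_ = _ ` ?Y")
  proof -
    have mem: "Q *v y \<in> E \<longleftrightarrow> y \<in> ?Y" for y
    proof -
      have "Q *v y \<in> E \<longleftrightarrow> (\<chi> i. d i * y $ i) = y"
        unfolding fixed[symmetric] PQ by (rule inj_eq[OF inj])
      also have "\<dots> \<longleftrightarrow> (\<forall>i. d i = 1 \<or> y $ i = 0)"
        by (auto simp: vec_eq_iff)
      finally show ?thesis by auto
    qed
    show ?thesis
    proof (intro equalityI subsetI)
      fix x assume "x \<in> E"
      have xx: "x = Q *v (transpose Q *v x)"
        using QQ(2) by (simp only: matrix_vector_mul_assoc matrix_vector_mul_lid)
      then have "Q *v (transpose Q *v x) \<in> E"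
        using \<open>x \<in> E\<close> by (rule subst)
      then show "x \<in> (*v) Q ` ?Y"
        unfolding mem by (rule image_eqI[of x "(*v) Q", OF xx])
    next
      fix x assume "x \<in> (*v) Q ` ?Y"
      then show "x \<in> E" using mem by (elim imageE) simp
    qed
  qed
  then have "dim E = dim ?Y"
    using dim_image_eq[OF matrix_vector_mul_linear, of Q ?Y] inj by (simp add: inj_on_subset)
  also have "\<dots> = card {i. d i = 1}"
    using dim_substandard_cart[where 'a=real, of "{i. d i = 1}"] by (simp add: dim_vec_eq)
  finally show ?thesis using that[OF Q P d] by simp
qed

section \<open>Expansion of \<open>sigma\<close> near a projection\<close>

lemma esym_zero_one:
  assumes "finite S" "\<And>i. i \<in> S \<Longrightarrow> d i = 0 \<or> d i = 1"
  shows "esym S d j = real (card {i\<in>S. d i = 1} choose j)"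
proof -
  let ?T = "{i\<in>S. d i = 1}"
  \<comment> \<open>Zero entries contribute the factor 1, so the generating polynomial is a power of
    \<open>1 + X\<close> with binomial coefficients.\<close>
  have "(\<Prod>i\<in>S. [:1, d i:]) = (\<Prod>i\<in>?T. [:1, d i:])"
    using assms by (intro prod.mono_neutral_right) (auto simp: one_pCons)
  also have "\<dots> = [:1, 1:] ^ card ?T"
    by simp
  finally have e: "esym S d j = coeff ([:1, 1:] ^ card ?T) j"
    by (simp add: esym_def)
  show ?thesis
  proof (cases "j \<le> card ?T")
    case False
    moreover have "degree ([:1, 1::real:] ^ card ?T) = card ?T"
      by (simp add: degree_power_eq)
    ultimately show ?thesis by (simp add: e coeff_eq_0)
  qed (simp add: e coeff_linear_poly_power)
qed

text \<open>Why a k-Hessian equation degenerates to a Laplace equation along \<open>V\<close>: a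
  projection of rank \<open>k - 1\<close> has \<open>sigma k\<close> equal to zero, and the linear
  term weights the directions by \<open>1 - d i\<close>, which are the eigenvalues of the
  complementary projection.\<close>

lemma sigma_near_projection:
  fixes E :: "(real^'n::finite) set"
  assumes E: "subspace E" "dim E + 1 = k"
  shows "\<exists>C\<ge>0. \<forall>\<delta>\<in>{0..1}. \<forall>M. transpose M = M \<and> (\<forall>i j. \<bar>M $ i $ j\<bar> \<le> B) \<longrightarrow>
    \<bar>sigma k (matrix (orth_proj E) + \<delta> *\<^sub>R M) - \<delta> * trace (matrix (orth_proj (E\<^sup>\<bottom>)) ** M)\<bar> \<le> C * \<delta>\<^sup>2"
proof -
  obtain Q d where Q: "orthogonal_matrix Q" and P: "matrix (orth_proj E) = Q ** diag_mat d ** transpose Q"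
    and d: "\<And>i. d i = 0 \<or> d i = 1" and c: "card {i. d i = 1} = dim E"
    using orth_proj_diagonalization[OF E(1)] by metis
  have e: "esym UNIV d (Suc (dim E)) = 0"
    using esym_zero_one[of UNIV d "Suc (dim E)"] d c by simp
  \<comment> \<open>Deleting an eigenvalue 1 leaves too few ones for a product of
    \<open>dim E\<close> of them; deleting a 0 leaves exactly one such product.\<close>
  have e1: "esym (UNIV - {i}) d (dim E) = 1 - d i" for i
  proof (cases "d i = 1")
    case True
    then have "{l \<in> UNIV - {i}. d l = 1} \<subset> {i. d i = 1}" by auto
    then have "card {l \<in> UNIV - {i}. d l = 1} < dim E"
      unfolding c[symmetric] by (intro psubset_card_mono) auto
    then show ?thesis
      using esym_zero_one[of "UNIV - {i}" d "dim E"] d True by simp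
  next
    case False
    then have "{l \<in> UNIV - {i}. d l = 1} = {i. d i = 1}" by auto
    then show ?thesis
      using esym_zero_one[of "UNIV - {i}" d "dim E"] d[of i] d False c by simp
  qed
  have tr: "(\<Sum>i\<in>UNIV. (transpose Q ** M ** Q) $ i $ i * (1 - d i)) = trace (matrix (orth_proj (E\<^sup>\<bottom>)) ** M)" for M
  proof -
    have "mat 1 - diag_mat d = diag_mat (\<lambda>i. 1 - d i)"
      by (auto simp: vec_eq_iff mat_def diag_mat_def)
    then have "matrix (orth_proj (E\<^sup>\<bottom>)) = Q ** diag_mat (\<lambda>i. 1 - d i) ** transpose Q"
      using orthogonal_conjugate_mat[OF Q, of 1]
      by (simp add: matrix_orth_proj_orthogonal_comp[OF E(1)] P matrix_algebra_simps flip: \<open>_ = diag_mat _\<close>)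
    then have "trace (matrix (orth_proj (E\<^sup>\<bottom>)) ** M) = trace ((Q ** diag_mat (\<lambda>i. 1 - d i)) ** (transpose Q ** M))"
      by (simp add: matrix_mul_assoc)
    also have "\<dots> = trace ((transpose Q ** M ** Q) ** diag_mat (\<lambda>i. 1 - d i))"
      by (subst trace_mul_sym) (simp add: matrix_mul_assoc)
    also have "\<dots> = (\<Sum>i\<in>UNIV. (transpose Q ** M ** Q) $ i $ i * (1 - d i))"
    proof -
      have "(X ** diag_mat g) $ i $ i = X $ i $ i * g i" for X :: "real^'n^'n" and g i
        by (simp add: matrix_matrix_mult_def diag_mat_def if_distrib cong: if_cong)
      then show ?thesis by (simp add: trace_def)
    qed
    finally show ?thesis by simp
  qed
  have k: "k = Suc (dim E)" using E(2) by simp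
  show ?thesis
    using sigma_perturbation[OF Q, of B "dim E" d] unfolding e e1 tr P k by simp
qed

text \<open>In degrees up to \<open>dim E\<close> the projection itself has the value
  \<open>dim E choose j \<ge> 1\<close>. A loss linear in \<delta> is enough, since this only serves
  to put the lower barrier into the cone.\<close>

lemma sigma_near_projection_lower:
  fixes E :: "(real^'n::finite) set"
  assumes E: "subspace E" "j \<in> {1..dim E}" and B: "0 \<le> B"
  shows "\<exists>C. \<forall>\<delta>\<in>{0..1}. \<forall>M. transpose M = M \<and> (\<forall>i j. \<bar>M $ i $ j\<bar> \<le> B) \<longrightarrow>
    sigma j (matrix (orth_proj E) + \<delta> *\<^sub>R M) \<ge> 1 - C * \<delta>"
proof -
  obtain Q d where Q: "orthogonal_matrix Q" and P: "matrix (orth_proj E) = Q ** diag_mat d ** transpose Q"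
    and d: "\<And>i. d i = 0 \<or> d i = 1" and c: "card {i. d i = 1} = dim E"
    using orth_proj_diagonalization[OF E(1)] by metis
  obtain m where m: "j = Suc m" using E(2) by (cases j) auto
  have e: "1 \<le> esym UNIV d j"
    using esym_zero_one[of UNIV d j] d c E(2) by (simp add: Suc_le_eq)
  \<comment> \<open>Bounds the first-order term uniformly in \<open>M\<close>, by writing out the
    diagonal of \<open>transpose Q ** M ** Q\<close>.\<close>
  define b where "b = (\<Sum>i\<in>UNIV. \<Sum>r\<in>UNIV. \<Sum>s\<in>UNIV. \<bar>Q $ s $ i\<bar> * B * \<bar>Q $ r $ i\<bar> * \<bar>esym (UNIV - {i}) d m\<bar>)"
  have b: "\<bar>\<Sum>i\<in>UNIV. (transpose Q ** M ** Q) $ i $ i * esym (UNIV - {i}) d m\<bar> \<le> b"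
    if M: "\<forall>i j. \<bar>M $ i $ j\<bar> \<le> B" for M
  proof -
    have "(\<Sum>i\<in>UNIV. (transpose Q ** M ** Q) $ i $ i * esym (UNIV - {i}) d m)
        = (\<Sum>i\<in>UNIV. \<Sum>r\<in>UNIV. \<Sum>s\<in>UNIV. Q $ s $ i * M $ s $ r * Q $ r $ i * esym (UNIV - {i}) d m)"
      by (simp add: matrix_matrix_mult_def transpose_def sum_distrib_right)
    also have "\<bar>\<dots>\<bar> \<le> (\<Sum>i\<in>UNIV. \<Sum>r\<in>UNIV. \<Sum>s\<in>UNIV. \<bar>Q $ s $ i * M $ s $ r * Q $ r $ i * esym (UNIV - {i}) d m\<bar>)"
      by (rule order_trans[OF sum_abs], rule sum_mono, rule order_trans[OF sum_abs], rule sum_mono, rule sum_abs)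
    also have "\<dots> \<le> b"
      unfolding b_def abs_mult using M by (intro sum_mono mult_right_mono mult_left_mono) auto
    finally show ?thesis .
  qed
  obtain C where C: "C \<ge> 0" and "\<forall>\<delta>\<in>{0..1}. \<forall>M. transpose M = M \<and> (\<forall>i j. \<bar>M $ i $ j\<bar> \<le> B) \<longrightarrow>
    \<bar>sigma j (matrix (orth_proj E) + \<delta> *\<^sub>R M) - esym UNIV d j
      - \<delta> * (\<Sum>i\<in>UNIV. (transpose Q ** M ** Q) $ i $ i * esym (UNIV - {i}) d m)\<bar> \<le> C * \<delta>\<^sup>2"
    using sigma_perturbation[OF Q, of B m d] unfolding P m by (elim exE conjE)
  note * = this(2)[rule_format]
  show ?thesis
  proof (intro exI[of _ "b + C"] ballI allI impI)
    fix \<delta> :: real and M :: "real^'n^'n"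
    assume \<delta>: "\<delta> \<in> {0..1}" and M: "transpose M = M \<and> (\<forall>i j. \<bar>M $ i $ j\<bar> \<le> B)"
    let ?s = "\<Sum>i\<in>UNIV. (transpose Q ** M ** Q) $ i $ i * esym (UNIV - {i}) d m"
    have "\<delta>\<^sup>2 \<le> \<delta>"
      using \<delta> by (simp add: power2_eq_square mult_left_le)
    then have "C * \<delta>\<^sup>2 \<le> C * \<delta>" using C by (rule mult_left_mono)
    moreover have "\<bar>\<delta> * ?s\<bar> \<le> \<delta> * b"
      unfolding abs_mult using b M \<delta> by (intro mult_mono) auto
    ultimately show "sigma j (matrix (orth_proj E) + \<delta> *\<^sub>R M) \<ge> 1 - (b + C) * \<delta>"
      using *[OF \<delta> M] e by (simp add: algebra_simps)
  qed
qed

section \<open>Second derivatives and the comparison principle\<close>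

lemma has_derivative_grad:
  fixes u :: "real^'n::finite \<Rightarrow> real"
  assumes "u differentiable (at x)"
  shows "(u has_derivative (\<lambda>h. grad u x \<bullet> h)) (at x)"
proof -
  let ?D = "frechet_derivative u (at x)"
  have D: "(u has_derivative ?D) (at x)"
    using assms frechet_derivative_works by blast
  then have lin: "linear ?D"
    by (rule has_derivative_linear)
  have "?D h = grad u x \<bullet> h" for h
  proof -
    have "?D h = ?D (\<Sum>i\<in>UNIV. h $ i *\<^sub>R axis i 1)"
      using basis_expansion[of h] by (simp add: scalar_mult_eq_scaleR)
    also have "\<dots> = (\<Sum>i\<in>UNIV. h $ i * ?D (axis i 1))"
      by (simp add: linear_sum[OF lin] linear_cmul[OF lin])
    also have "\<dots> = grad u x \<bullet> h"
      by (simp add: inner_vec_def grad_def partial_deriv_def mult.commute)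
    finally show ?thesis .
  qed
  then show ?thesis by (intro has_derivative_eq_rhs[OF D] ext)
qed

lemma has_real_derivative_line:
  fixes u :: "real^'n::finite \<Rightarrow> real"
  assumes "(u has_derivative (\<lambda>h. g \<bullet> h)) (at (p + s *\<^sub>R v))"
  shows "((\<lambda>s. u (p + s *\<^sub>R v)) has_real_derivative (g \<bullet> v)) (at s)"
proof -
  have "((\<lambda>s. p + s *\<^sub>R v) has_derivative (\<lambda>r. r *\<^sub>R v)) (at s)"
    by (auto intro!: derivative_eq_intros)
  from has_derivative_compose[OF this assms] show ?thesis
    unfolding has_field_derivative_def by (rule has_derivative_eq_rhs) (simp add: fun_eq_iff)
qed

text \<open>The mean value theorem in direction \<open>i\<close> turns the second difference into a
  difference of \<open>partial_deriv i f\<close>, and differentiability of that function at the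
  single point \<open>x\<close> evaluates it.\<close>

lemma second_difference_quotient:
  fixes f :: "real^'n::finite \<Rightarrow> real"
  assumes "open S" "x \<in> S" and f: "\<And>y. y \<in> S \<Longrightarrow> f differentiable (at y)"
    and g: "partial_deriv i f differentiable (at x)"
  shows "((\<lambda>h. (f (x + h *\<^sub>R axis i 1 + h *\<^sub>R axis j 1) - f (x + h *\<^sub>R axis i 1) - f (x + h *\<^sub>R axis j 1) + f x) / h\<^sup>2)
    \<longlongrightarrow> partial_deriv j (partial_deriv i f) x) (at_right 0)"
proof (rule tendstoI)
  fix e :: real assume "e > 0"
  let ?g = "partial_deriv i f" and ?a = "axis i 1 :: real^'n" and ?b = "axis j 1 :: real^'n"
  let ?L = "\<lambda>h. grad ?g x \<bullet> h"
  \<comment> \<open>The estimate is used at two points within \<open>2 * h\<close> of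
    \<open>x\<close>, so \<open>e / 5\<close> gives a total of \<open>4 / 5 * e * h\<close>,
    strictly below \<open>e * h\<close>.\<close>
  obtain d where d: "d > 0" and dL: "\<And>y. norm (y - x) < d \<Longrightarrow> \<bar>?g y - ?g x - ?L (y - x)\<bar> \<le> e / 5 * norm (y - x)"
    using has_derivative_grad[OF g] \<open>e > 0\<close> unfolding has_derivative_at_alt
    by (metis divide_pos_pos real_norm_def zero_less_numeral)
  obtain r where r: "r > 0" "ball x r \<subseteq> S"
    using assms(1,2) openE by blast
  have L: "?L ?b = partial_deriv j ?g x"
    by (simp add: inner_axis grad_def)
  show "\<forall>\<^sub>F h in at_right 0. dist ((f (x + h *\<^sub>R ?a + h *\<^sub>R ?b) - f (x + h *\<^sub>R ?a) - f (x + h *\<^sub>R ?b) + f x) / h\<^sup>2) (partial_deriv j ?g x) < e"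
    unfolding eventually_at_right_field
  proof (intro exI[of _ "min d r / 2"] conjI allI impI)
    show "0 < min d r / 2" using d r by simp
    fix h :: real assume h: "0 < h" "h < min d r / 2"
    have nrm: "norm (s *\<^sub>R ?a + c *\<^sub>R ?b) \<le> 2 * h" if "0 \<le> s" "s \<le> h" "0 \<le> c" "c \<le> h" for s c
      using norm_triangle_ineq[of "s *\<^sub>R ?a" "c *\<^sub>R ?b"] that by simp
    have inS: "x + s *\<^sub>R ?a + c *\<^sub>R ?b \<in> S" if "0 \<le> s" "s \<le> h" "0 \<le> c" "c \<le> h" for s c
    proof -
      have "dist x (x + s *\<^sub>R ?a + c *\<^sub>R ?b) = norm (s *\<^sub>R ?a + c *\<^sub>R ?b)"
        using norm_minus_cancel[of "s *\<^sub>R ?a + c *\<^sub>R ?b"] by (simp add: dist_norm)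
      then show ?thesis using nrm[OF that] h r(2) by auto
    qed
    have D: "((\<lambda>s. f (x + c *\<^sub>R ?b + s *\<^sub>R ?a)) has_real_derivative ?g (x + s *\<^sub>R ?a + c *\<^sub>R ?b)) (at s)"
      if "0 \<le> s" "s \<le> h" "0 \<le> c" "c \<le> h" for s c
    proof -
      have "f differentiable (at (x + c *\<^sub>R ?b + s *\<^sub>R ?a))"
        using f inS[OF that] by (simp add: algebra_simps)
      from has_real_derivative_line[OF has_derivative_grad[OF this]] show ?thesis
        by (simp add: inner_axis grad_def algebra_simps)
    qed
    \<comment> \<open>The difference across direction \<open>j\<close> as a function of the
      displacement in direction \<open>i\<close>; its increment over \<open>[0, h]\<close> is the
      second difference.\<close>
    let ?\<phi> = "\<lambda>s. f (x + h *\<^sub>R ?b + s *\<^sub>R ?a) - f (x + 0 *\<^sub>R ?b + s *\<^sub>R ?a)"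
    have "\<exists>z>0. z < h \<and> ?\<phi> h - ?\<phi> 0 = (h - 0) * (?g (x + z *\<^sub>R ?a + h *\<^sub>R ?b) - ?g (x + z *\<^sub>R ?a + 0 *\<^sub>R ?b))"
      using h by (intro MVT2 DERIV_diff D) auto
    then obtain z where z: "0 < z" "z < h" and eq: "?\<phi> h - ?\<phi> 0 = h * (?g (x + z *\<^sub>R ?a + h *\<^sub>R ?b) - ?g (x + z *\<^sub>R ?a))"
      by auto
    have R: "\<bar>?g (x + z *\<^sub>R ?a + c *\<^sub>R ?b) - ?g x - ?L (z *\<^sub>R ?a + c *\<^sub>R ?b)\<bar> \<le> e / 5 * (2 * h)" if "0 \<le> c" "c \<le> h" for c
    proof -
      have n: "norm (z *\<^sub>R ?a + c *\<^sub>R ?b) \<le> 2 * h" using nrm z that by simp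
      have "\<bar>?g (x + z *\<^sub>R ?a + c *\<^sub>R ?b) - ?g x - ?L (x + z *\<^sub>R ?a + c *\<^sub>R ?b - x)\<bar> \<le> e / 5 * norm (x + z *\<^sub>R ?a + c *\<^sub>R ?b - x)"
        using n h by (intro dL) (simp add: add.assoc)
      also have "\<dots> \<le> e / 5 * (2 * h)"
        using n \<open>e > 0\<close> by (intro mult_left_mono) (auto simp: add.assoc)
      finally show ?thesis by (simp add: add.assoc)
    qed
    have R0: "\<bar>?g (x + z *\<^sub>R ?a) - ?g x - ?L (z *\<^sub>R ?a + 0 *\<^sub>R ?b)\<bar> \<le> e / 5 * (2 * h)"
      using R[of 0] h(1) by simp
    have "?L (z *\<^sub>R ?a + h *\<^sub>R ?b) = ?L (z *\<^sub>R ?a + 0 *\<^sub>R ?b) + h * ?L ?b"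
      by (simp add: inner_add_right)
    then have "\<bar>(?g (x + z *\<^sub>R ?a + h *\<^sub>R ?b) - ?g (x + z *\<^sub>R ?a)) - h * ?L ?b\<bar> \<le> 4 / 5 * e * h"
      using R[of h] R0 h(1) by linarith
    also have "\<dots> < e * h" using h \<open>e > 0\<close> by simp
    finally have *: "\<bar>(?g (x + z *\<^sub>R ?a + h *\<^sub>R ?b) - ?g (x + z *\<^sub>R ?a)) - h * ?L ?b\<bar> < e * h" .
    have "(f (x + h *\<^sub>R ?a + h *\<^sub>R ?b) - f (x + h *\<^sub>R ?a) - f (x + h *\<^sub>R ?b) + f x) / h\<^sup>2 - ?L ?b
       = ((?g (x + z *\<^sub>R ?a + h *\<^sub>R ?b) - ?g (x + z *\<^sub>R ?a)) - h * ?L ?b) / h"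
    proof -
      have N: "f (x + h *\<^sub>R ?a + h *\<^sub>R ?b) - f (x + h *\<^sub>R ?a) - f (x + h *\<^sub>R ?b) + f x
         = h * (?g (x + z *\<^sub>R ?a + h *\<^sub>R ?b) - ?g (x + z *\<^sub>R ?a))"
        using eq by (simp add: algebra_simps)
      show ?thesis
        unfolding N using h by (simp add: power2_eq_square diff_divide_distrib)
    qed
    then show "dist ((f (x + h *\<^sub>R ?a + h *\<^sub>R ?b) - f (x + h *\<^sub>R ?a) - f (x + h *\<^sub>R ?b) + f x) / h\<^sup>2) (partial_deriv j ?g x) < e"
      using * h by (simp add: dist_real_def flip: L) (simp add: field_simps)
  qed
qed

text \<open>The second difference is symmetric in the two directions, while its limit is one or the
  other mixed derivative.\<close>

lemma partial_deriv_commute: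
  fixes f :: "real^'n::finite \<Rightarrow> real"
  assumes "open S" "x \<in> S" "\<And>y. y \<in> S \<Longrightarrow> f differentiable (at y)"
    and "partial_deriv i f differentiable (at x)" "partial_deriv j f differentiable (at x)"
  shows "partial_deriv i (partial_deriv j f) x = partial_deriv j (partial_deriv i f) x"
proof -
  have "((\<lambda>h. (f (x + h *\<^sub>R axis i 1 + h *\<^sub>R axis j 1) - f (x + h *\<^sub>R axis i 1) - f (x + h *\<^sub>R axis j 1) + f x) / h\<^sup>2)
    \<longlongrightarrow> partial_deriv i (partial_deriv j f) x) (at_right 0)"
    using second_difference_quotient[OF assms(1-3,5), of i] by (simp add: algebra_simps)
  then show ?thesis
    using second_difference_quotient[OF assms(1-4), of j] tendsto_unique trivial_limit_at_right_real by blast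
qed

text \<open>Gradient and Hessian fields are carried explicitly, so that those of the barriers are
  obtained by linearity from the ones of \<phi> and w. Row \<open>i\<close> of \<open>H x\<close> is
  the gradient of the \<open>i\<close>-th component of \<open>G\<close>.\<close>

definition twice_differentiable_on ::
  "(real^'n::finite) set \<Rightarrow> (real^'n \<Rightarrow> real) \<Rightarrow> (real^'n \<Rightarrow> real^'n) \<Rightarrow> (real^'n \<Rightarrow> real^'n^'n) \<Rightarrow> bool"
where
  "twice_differentiable_on S z G H \<longleftrightarrow>
     (\<forall>x\<in>S. (z has_derivative (\<lambda>h. G x \<bullet> h)) (at x) \<and>
       (\<forall>i. ((\<lambda>y. G y $ i) has_derivative (\<lambda>h. H x $ i \<bullet> h)) (at x)))"

lemma twice_differentiable_on_add:
  assumes "twice_differentiable_on S z G H" "twice_differentiable_on S z' G' H'"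
  shows "twice_differentiable_on S (\<lambda>x. z x + z' x) (\<lambda>x. G x + G' x) (\<lambda>x. H x + H' x)"
  unfolding twice_differentiable_on_def
proof (intro ballI conjI allI)
  fix x i assume "x \<in> S"
  then have *: "(z has_derivative (\<lambda>h. G x \<bullet> h)) (at x)" "(z' has_derivative (\<lambda>h. G' x \<bullet> h)) (at x)"
    "((\<lambda>y. G y $ i) has_derivative (\<lambda>h. H x $ i \<bullet> h)) (at x)" "((\<lambda>y. G' y $ i) has_derivative (\<lambda>h. H' x $ i \<bullet> h)) (at x)"
    using assms unfolding twice_differentiable_on_def by blast+
  show "((\<lambda>x. z x + z' x) has_derivative (\<lambda>h. (G x + G' x) \<bullet> h)) (at x)"
    by (rule has_derivative_eq_rhs[OF has_derivative_add[OF *(1,2)]]) (simp add: fun_eq_iff inner_add_left)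
  show "((\<lambda>y. (G y + G' y) $ i) has_derivative (\<lambda>h. (H x + H' x) $ i \<bullet> h)) (at x)"
    unfolding vector_add_component
    by (rule has_derivative_eq_rhs[OF has_derivative_add[OF *(3,4)]]) (simp add: fun_eq_iff inner_add_left)
qed

lemma twice_differentiable_on_cmult:
  assumes "twice_differentiable_on S z G H"
  shows "twice_differentiable_on S (\<lambda>x. c * z x) (\<lambda>x. c *\<^sub>R G x) (\<lambda>x. c *\<^sub>R H x)"
  unfolding twice_differentiable_on_def
proof (intro ballI conjI allI)
  fix x i assume "x \<in> S"
  then have *: "(z has_derivative (\<lambda>h. G x \<bullet> h)) (at x)" "((\<lambda>y. G y $ i) has_derivative (\<lambda>h. H x $ i \<bullet> h)) (at x)"
    using assms unfolding twice_differentiable_on_def by blast+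
  show "((\<lambda>x. c * z x) has_derivative (\<lambda>h. (c *\<^sub>R G x) \<bullet> h)) (at x)"
    by (rule has_derivative_eq_rhs[OF has_derivative_mult_right[OF *(1)]]) (simp add: fun_eq_iff)
  show "((\<lambda>y. (c *\<^sub>R G y) $ i) has_derivative (\<lambda>h. (c *\<^sub>R H x) $ i \<bullet> h)) (at x)"
    unfolding vector_scaleR_component real_scaleR_def
    by (rule has_derivative_eq_rhs[OF has_derivative_mult_right[OF *(2)]]) (simp add: fun_eq_iff)
qed

lemma smooth_on_differentiable:
  assumes "open S" "smooth_on S u" "x \<in> S"
  shows "iter_partial is u differentiable (at x)"
proof -
  have "iter_partial is u differentiable (at x within S)"
    using assms(2,3) unfolding smooth_on_def differentiable_on_def by blast
  then show ?thesis
    by (simp only: at_within_open[OF assms(3,1)])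
qed

lemma transpose_hessian:
  assumes "open S" "smooth_on S u" "x \<in> S"
  shows "transpose (hessian u x) = hessian u x"
proof -
  have "partial_deriv i (partial_deriv j u) x = partial_deriv j (partial_deriv i u) x" for i j
    using smooth_on_differentiable[OF assms(1,2), of _ "[]"] smooth_on_differentiable[OF assms, of "[i]"]
      smooth_on_differentiable[OF assms, of "[j]"]
    by (intro partial_deriv_commute[OF assms(1,3)]) auto
  then show ?thesis
    by (simp add: hessian_def transpose_def vec_eq_iff)
qed

lemma twice_differentiable_on_smooth:
  assumes "open S" "smooth_on S u"
  shows "twice_differentiable_on S u (grad u) (hessian u)"
  unfolding twice_differentiable_on_def
proof (intro ballI conjI allI)
  fix x assume x: "x \<in> S"
  show "(u has_derivative (\<lambda>h. grad u x \<bullet> h)) (at x)"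
    using smooth_on_differentiable[OF assms x, of "[]"] by (simp add: has_derivative_grad)
  fix i
  \<comment> \<open>The left side lists \<open>\<partial>_j \<partial>_i u\<close> and the right
    side \<open>\<partial>_i \<partial>_j u\<close>, hence the appeal to symmetry of the
    Hessian.\<close>
  have "grad (partial_deriv i u) x = hessian u x $ i"
    using transpose_hessian[OF assms x] by (simp add: grad_def hessian_def transpose_def vec_eq_iff)
  then show "((\<lambda>y. grad u y $ i) has_derivative (\<lambda>h. hessian u x $ i \<bullet> h)) (at x)"
    using has_derivative_grad[OF smooth_on_differentiable[OF assms x, of "[i]", simplified]]
    by (simp add: grad_def)
qed

text \<open>Along the line in direction \<open>v\<close> the slope vanishes at the maximum. If the
  second derivative were positive, the slope would be positive just to the right, and the mean value
  theorem would give larger values there.\<close>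

lemma second_derivative_nonpos_at_max:
  assumes z: "twice_differentiable_on S z G H" and S: "open S" "x \<in> S"
    and max: "\<And>y. y \<in> S \<Longrightarrow> z y \<le> z x"
  shows "v \<bullet> (H x *v v) \<le> 0"
proof (rule ccontr)
  assume "\<not> v \<bullet> (H x *v v) \<le> 0"
  then have pos: "0 < v \<bullet> (H x *v v)" by simp
  have "open ((\<lambda>s. x + s *\<^sub>R v) -` S)"
    using S by (intro open_vimage continuous_intros)
  moreover have "0 \<in> (\<lambda>s. x + s *\<^sub>R v) -` S" using S by simp
  ultimately obtain r where "r > 0" "ball 0 r \<subseteq> (\<lambda>s. x + s *\<^sub>R v) -` S"
    using openE by blast
  then have r: "r > 0" "\<And>s. \<bar>s\<bar> < r \<Longrightarrow> x + s *\<^sub>R v \<in> S"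
    by (auto simp: subset_iff dist_real_def)
  have g: "((\<lambda>s. z (x + s *\<^sub>R v)) has_real_derivative (G (x + s *\<^sub>R v) \<bullet> v)) (at s)" if "\<bar>s\<bar> < r" for s
    using z r(2)[OF that] unfolding twice_differentiable_on_def by (intro has_real_derivative_line) blast
  have "((\<lambda>s. G (x + s *\<^sub>R v) \<bullet> v) has_real_derivative (v \<bullet> (H x *v v))) (at 0)"
  proof -
    have "((\<lambda>s. \<Sum>i\<in>UNIV. (G (x + s *\<^sub>R v)) $ i * v $ i) has_real_derivative (\<Sum>i\<in>UNIV. (H x $ i \<bullet> v) * v $ i)) (at 0)"
    proof (intro DERIV_sum DERIV_cmult_right)
      fix i
      have "((\<lambda>y. G y $ i) has_derivative (\<lambda>h. H x $ i \<bullet> h)) (at (x + 0 *\<^sub>R v))"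
        using z S unfolding twice_differentiable_on_def by simp
      then show "((\<lambda>s. G (x + s *\<^sub>R v) $ i) has_real_derivative (H x $ i \<bullet> v)) (at 0)"
        by (rule has_real_derivative_line)
    qed
    then show ?thesis
      by (simp add: inner_vec_def matrix_vector_mult_def mult.commute)
  qed
  then obtain d where d: "d > 0" "\<And>h. 0 < h \<Longrightarrow> h < d \<Longrightarrow> G (x + 0 *\<^sub>R v) \<bullet> v < G (x + (0 + h) *\<^sub>R v) \<bullet> v"
    using DERIV_pos_inc_right[OF _ pos] by blast
  have 0: "G (x + 0 *\<^sub>R v) \<bullet> v = 0"
    by (rule DERIV_local_max[OF g \<open>r > 0\<close>]) (use r max in \<open>auto simp: abs_minus_commute\<close>)
  define s where "s = min r d / 2"
  have s: "0 < s" "s < r" "s < d" using r d by (auto simp: s_def)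
  then have "\<exists>c>0. c < s \<and> z (x + s *\<^sub>R v) - z (x + 0 *\<^sub>R v) = (s - 0) * (G (x + c *\<^sub>R v) \<bullet> v)"
    by (intro MVT2 g) auto
  then obtain c where c: "0 < c" "c < s" "z (x + s *\<^sub>R v) - z x = s * (G (x + c *\<^sub>R v) \<bullet> v)"
    by auto
  have "0 < G (x + c *\<^sub>R v) \<bullet> v"
    using d(2)[of c] c s 0 by simp
  then have "0 < s * (G (x + c *\<^sub>R v) \<bullet> v)" using s by simp
  then show False
    using c(3) max[OF r(2)[of s]] s by simp
qed

text \<open>At an interior positive maximum of \<open>a - b\<close> the matrix
  \<open>Hb - Ha\<close> is nonnegative, so monotonicity contradicts the strict inequality
  \<open>less\<close>. Positivity is asked of \<open>Ha\<close>, where \<open>sigma_mono\<close>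
  starts; this is what admits the upper barrier in the role of \<open>b\<close>.\<close>

lemma k_hessian_comparison:
  fixes a b :: "real^'n::finite \<Rightarrow> real"
  assumes \<Omega>: "open \<Omega>" "bounded \<Omega>" and "1 \<le> k"
    and a: "twice_differentiable_on \<Omega> a Ga Ha" "continuous_on (closure \<Omega>) a"
    and b: "twice_differentiable_on \<Omega> b Gb Hb" "continuous_on (closure \<Omega>) b"
    and sym: "\<And>x. x \<in> \<Omega> \<Longrightarrow> transpose (Ha x) = Ha x" "\<And>x. x \<in> \<Omega> \<Longrightarrow> transpose (Hb x) = Hb x"
    and pos: "\<And>x j. x \<in> \<Omega> \<Longrightarrow> j \<in> {1..k} \<Longrightarrow> 0 < sigma j (Ha x)"
    and less: "\<And>x. x \<in> \<Omega> \<Longrightarrow> sigma k (Hb x) < sigma k (Ha x)"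
    and bdry: "\<And>x. x \<in> frontier \<Omega> \<Longrightarrow> a x \<le> b x"
    and x: "x \<in> \<Omega>"
  shows "a x \<le> b x"
proof (rule ccontr)
  assume "\<not> a x \<le> b x"
  let ?z = "\<lambda>x. a x + (- 1) * b x"
  have "compact (closure \<Omega>)" "closure \<Omega> \<noteq> {}"
    using \<Omega> x closure_subset by (auto simp: compact_closure)
  moreover have "continuous_on (closure \<Omega>) ?z"
    using a b by (intro continuous_intros)
  ultimately obtain p where p: "p \<in> closure \<Omega>" and max: "\<And>y. y \<in> closure \<Omega> \<Longrightarrow> ?z y \<le> ?z p"
    using continuous_attains_sup[of "closure \<Omega>" ?z] by blast
  have "0 < ?z p"
    using max[of x] x closure_subset \<open>\<not> a x \<le> b x\<close> by fastforce
  then have p\<Omega>: "p \<in> \<Omega>"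
    using bdry[of p] p \<Omega>(1) by (cases "p \<in> frontier \<Omega>") (auto simp: frontier_def interior_open)
  have z: "twice_differentiable_on \<Omega> ?z (\<lambda>x. Ga x + (- 1) *\<^sub>R Gb x) (\<lambda>x. Ha x + (- 1) *\<^sub>R Hb x)"
    using a b by (intro twice_differentiable_on_add twice_differentiable_on_cmult)
  let ?N = "Hb p - Ha p"
  have N: "0 \<le> v \<bullet> (?N *v v)" for v
    using second_derivative_nonpos_at_max[OF z \<Omega>(1) p\<Omega>, of v] max closure_subset
    by (fastforce simp: matrix_vector_mult_diff_rdistrib inner_diff_right)
  have "transpose ?N = ?N"
    using sym[OF p\<Omega>] by (simp add: transpose_def vec_eq_iff)
  then have "sigma k (Ha p) \<le> sigma k (Ha p + ?N)"
    using N pos[OF p\<Omega>] sym[OF p\<Omega>] \<open>1 \<le> k\<close> by (intro sigma_mono)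
  then show False
    using less[OF p\<Omega>] by simp
qed

section \<open>Derivatives along the normal\<close>

text \<open>A negative value would put \<open>p\<close> into the open set, and by continuity a
  positive one would keep a whole neighbourhood of \<open>p\<close> away from it.\<close>

lemma local_defining_function_eq_0:
  assumes "local_defining_function \<Omega> p U \<rho>" "open \<Omega>" "p \<in> frontier \<Omega>"
  shows "\<rho> p = 0"
proof (rule ccontr)
  assume "\<rho> p \<noteq> 0"
  have U: "open U" "p \<in> U" "smooth_on U \<rho>" "\<Omega> \<inter> U = {x\<in>U. \<rho> x < 0}"
    using assms(1) by (auto simp: local_defining_function_def)
  have "p \<notin> \<Omega>" "p \<in> closure \<Omega>"
    using assms(2,3) by (auto simp: frontier_def interior_open)
  then have "0 < \<rho> p"
    using U \<open>\<rho> p \<noteq> 0\<close> by (smt (verit) IntI Int_commute mem_Collect_eq IntE)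
  moreover have "isCont \<rho> p"
    using smooth_on_differentiable[OF U(1,3,2), of "[]"] differentiable_imp_continuous_within by auto
  ultimately have "\<forall>\<^sub>F x in nhds p. 0 < \<rho> x"
    by (auto simp: isCont_def eventually_nhds_conv_at intro: order_tendstoD(1))
  moreover have "\<forall>\<^sub>F x in nhds p. x \<in> U"
    using U(1,2) by (rule eventually_nhds_in_open)
  ultimately have "\<forall>\<^sub>F x in nhds p. x \<in> U \<and> 0 < \<rho> x"
    by eventually_elim simp
  then obtain V where V: "open V" "p \<in> V" "\<And>x. x \<in> V \<Longrightarrow> x \<in> U \<and> 0 < \<rho> x"
    unfolding eventually_nhds by blast
  then have "V \<inter> \<Omega> = {}"
    using U(4) by force
  then show False
    using V(1,2) \<open>p \<in> closure \<Omega>\<close> open_Int_closure_eq_empty by blast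
qed

lemma local_defining_function_ray:
  assumes \<rho>: "local_defining_function \<Omega> p U \<rho>" and \<Omega>: "open \<Omega>" "p \<in> frontier \<Omega>"
  shows "grad \<rho> p \<bullet> v < 0 \<Longrightarrow> \<exists>d>0. \<forall>h>0. h < d \<longrightarrow> p + h *\<^sub>R v \<in> \<Omega>"
    and "grad \<rho> p \<bullet> v > 0 \<Longrightarrow> \<exists>d>0. \<forall>h>0. h < d \<longrightarrow> p + h *\<^sub>R v \<notin> \<Omega>"
proof -
  have U: "open U" "p \<in> U" "smooth_on U \<rho>" "\<Omega> \<inter> U = {x\<in>U. \<rho> x < 0}"
    using \<rho> by (auto simp: local_defining_function_def)
  have D: "((\<lambda>h. \<rho> (p + h *\<^sub>R v)) has_real_derivative (grad \<rho> p \<bullet> v)) (at 0)"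
    using has_derivative_grad[OF smooth_on_differentiable[OF U(1,3,2), of "[]"]]
    by (intro has_real_derivative_line) simp
  have "open ((\<lambda>h. p + h *\<^sub>R v) -` U)"
    using U by (intro open_vimage continuous_intros)
  then obtain r where "r > 0" "ball 0 r \<subseteq> (\<lambda>h. p + h *\<^sub>R v) -` U"
    using U(2) by (metis (no_types, lifting) add.right_neutral openE scaleR_zero_left vimageI)
  then have r: "r > 0" "\<And>h. \<bar>h\<bar> < r \<Longrightarrow> p + h *\<^sub>R v \<in> U"
    by (auto simp: subset_iff dist_real_def)
  have 0: "\<rho> (p + 0 *\<^sub>R v) = 0"
    using local_defining_function_eq_0[OF \<rho> \<Omega>] by simp
  show "\<exists>d>0. \<forall>h>0. h < d \<longrightarrow> p + h *\<^sub>R v \<in> \<Omega>" if neg: "grad \<rho> p \<bullet> v < 0"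
  proof -
    obtain d where d: "d > 0" "\<And>h. 0 < h \<Longrightarrow> h < d \<Longrightarrow> \<rho> (p + (0 + h) *\<^sub>R v) < \<rho> (p + 0 *\<^sub>R v)"
      using DERIV_neg_dec_right[OF D neg] by blast
    have "p + h *\<^sub>R v \<in> \<Omega>" if "0 < h" "h < min d r" for h
      using d(2)[of h] r(2)[of h] that 0 U(4) by auto
    then show ?thesis using d r by (intro exI[of _ "min d r"]) simp
  qed
  show "\<exists>d>0. \<forall>h>0. h < d \<longrightarrow> p + h *\<^sub>R v \<notin> \<Omega>" if pos: "grad \<rho> p \<bullet> v > 0"
  proof -
    obtain d where d: "d > 0" "\<And>h. 0 < h \<Longrightarrow> h < d \<Longrightarrow> \<rho> (p + 0 *\<^sub>R v) < \<rho> (p + (0 + h) *\<^sub>R v)"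
      using DERIV_pos_inc_right[OF D pos] by blast
    have "p + h *\<^sub>R v \<notin> \<Omega>" if "0 < h" "h < min d r" for h
    proof
      assume "p + h *\<^sub>R v \<in> \<Omega>"
      then have "\<rho> (p + h *\<^sub>R v) < 0" using r(2)[of h] that U(4) by auto
      then show False using d(2)[of h] that 0 by simp
    qed
    then show ?thesis using d r by (intro exI[of _ "min d r"]) simp
  qed
qed

text \<open>If the unit normals \<open>a\<close> and \<open>b\<close> differed, a short ray in
  direction \<open>b - a\<close> would lie inside the domain according to the first defining
  function and outside according to the second.\<close>

lemma local_defining_function_normal_unique:
  assumes \<rho>: "local_defining_function \<Omega> p U \<rho>" "local_defining_function \<Omega> p U' \<rho>'"
    and \<Omega>: "open \<Omega>" "p \<in> frontier \<Omega>"
  shows "grad \<rho> p /\<^sub>R norm (grad \<rho> p) = grad \<rho>' p /\<^sub>R norm (grad \<rho>' p)"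
proof (rule ccontr)
  let ?a = "grad \<rho> p /\<^sub>R norm (grad \<rho> p)" and ?b = "grad \<rho>' p /\<^sub>R norm (grad \<rho>' p)"
  assume ne: "?a \<noteq> ?b"
  have n: "0 < norm (grad \<rho> p)" "0 < norm (grad \<rho>' p)"
    using \<rho> by (auto simp: local_defining_function_def)
  then have "norm ?a = 1" "norm ?b = 1" by auto
  then have ab: "?a \<bullet> ?a = 1" "?b \<bullet> ?b = 1" by (simp_all only: norm_eq_1)
  have "0 < (?b - ?a) \<bullet> (?b - ?a)" using ne by simp
  then have lt: "?a \<bullet> ?b < 1"
    using ab by (simp only: inner_diff_left inner_diff_right inner_commute[of ?b ?a])
  have g: "grad \<rho> p \<bullet> v = norm (grad \<rho> p) * (?a \<bullet> v)" "grad \<rho>' p \<bullet> v = norm (grad \<rho>' p) * (?b \<bullet> v)" for v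
    using n by simp_all
  have "?a \<bullet> (?b - ?a) < 0" "0 < ?b \<bullet> (?b - ?a)"
    using lt ab by (simp_all only: inner_diff_right inner_commute[of ?b ?a])
  then have "grad \<rho> p \<bullet> (?b - ?a) < 0" "0 < grad \<rho>' p \<bullet> (?b - ?a)"
    unfolding g using n by (simp_all only: mult_less_0_iff zero_less_mult_iff simp_thms)
  then obtain d d' where d: "d > 0" "\<And>h. 0 < h \<Longrightarrow> h < d \<Longrightarrow> p + h *\<^sub>R (?b - ?a) \<in> \<Omega>"
    and d': "d' > 0" "\<And>h. 0 < h \<Longrightarrow> h < d' \<Longrightarrow> p + h *\<^sub>R (?b - ?a) \<notin> \<Omega>"
    using local_defining_function_ray(1)[OF \<rho>(1) \<Omega>, of "?b - ?a"] local_defining_function_ray(2)[OF \<rho>(2) \<Omega>, of "?b - ?a"]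
    by blast
  then show False
    using field_lbound_gt_zero[OF d(1) d'(1)] d(2) d'(2) by blast
qed

lemma outward_normal_inward_ray:
  assumes \<Omega>: "smooth_domain \<Omega>" and p: "p \<in> frontier \<Omega>"
  shows "norm (outward_normal \<Omega> p) = 1"
    and "\<exists>d>0. \<forall>h. - d < h \<and> h < 0 \<longrightarrow> p + h *\<^sub>R outward_normal \<Omega> p \<in> \<Omega>"
proof -
  obtain U \<rho> where \<rho>: "local_defining_function \<Omega> p U \<rho>" and op: "open \<Omega>"
    using assms unfolding smooth_domain_def by blast
  have \<nu>: "outward_normal \<Omega> p = grad \<rho> p /\<^sub>R norm (grad \<rho> p)"
    unfolding outward_normal_def
    by (rule the_equality) (use \<rho> local_defining_function_normal_unique[OF _ _ op p] in blast)+
  have n: "grad \<rho> p \<noteq> 0"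
    using \<rho> by (auto simp: local_defining_function_def)
  then show "norm (outward_normal \<Omega> p) = 1"
    by (simp add: \<nu>)
  have "grad \<rho> p \<bullet> - outward_normal \<Omega> p < 0"
    using n by (simp add: \<nu>)
  then obtain d where d: "d > 0" "\<And>h. 0 < h \<Longrightarrow> h < d \<Longrightarrow> p + h *\<^sub>R - outward_normal \<Omega> p \<in> \<Omega>"
    using local_defining_function_ray(1)[OF \<rho> op p] by blast
  have "p + h *\<^sub>R outward_normal \<Omega> p \<in> \<Omega>" if "- d < h" "h < 0" for h
    using d(2)[of "- h"] that by simp
  then show "\<exists>d>0. \<forall>h. - d < h \<and> h < 0 \<longrightarrow> p + h *\<^sub>R outward_normal \<Omega> p \<in> \<Omega>"
    using d(1) by blast
qed

text \<open>Differentiability is available in the interior. The mean value theorem expresses the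
  quotient at the boundary point through \<open>g\<close> at an interior point of the ray, and
  continuity of \<open>g\<close> up to the boundary gives the limit.\<close>

lemma has_vector_derivative_inward_ray:
  assumes \<Omega>: "smooth_domain \<Omega>" and p: "p \<in> frontier \<Omega>"
    and u: "continuous_on (closure \<Omega>) u" "\<And>x. x \<in> \<Omega> \<Longrightarrow> (u has_derivative (\<lambda>h. g x \<bullet> h)) (at x)"
    and g: "continuous_on (closure \<Omega>) g"
  shows "((\<lambda>h. u (p + h *\<^sub>R outward_normal \<Omega> p)) has_vector_derivative (g p \<bullet> outward_normal \<Omega> p)) (at 0 within {..0})"
proof -
  let ?\<nu> = "outward_normal \<Omega> p"
  let ?F = "\<lambda>h. u (p + h *\<^sub>R ?\<nu>)" and ?G = "\<lambda>h. g (p + h *\<^sub>R ?\<nu>) \<bullet> ?\<nu>"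
  obtain d where d: "d > 0" "\<And>h. - d < h \<Longrightarrow> h < 0 \<Longrightarrow> p + h *\<^sub>R ?\<nu> \<in> \<Omega>"
    using outward_normal_inward_ray(2)[OF \<Omega> p] by blast
  have cl: "(\<lambda>h. p + h *\<^sub>R ?\<nu>) ` {- d<..0} \<subseteq> closure \<Omega>"
  proof (rule image_subsetI)
    fix h assume h: "h \<in> {- d<..0}"
    show "p + h *\<^sub>R ?\<nu> \<in> closure \<Omega>"
    proof (cases "h = 0")
      case True
      then show ?thesis using p by (simp add: frontier_def)
    next
      case False
      then show ?thesis using h d(2)[of h] closure_subset by auto
    qed
  qed
  have F: "continuous_on {- d<..0} ?F"
    by (rule continuous_on_compose2[OF u(1) _ cl]) (intro continuous_intros)
  have "continuous_on {- d<..0} (\<lambda>h. g (p + h *\<^sub>R ?\<nu>))"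
    by (rule continuous_on_compose2[OF g _ cl]) (intro continuous_intros)
  then have "continuous_on {- d<..0} ?G"
    by (intro continuous_intros)
  then have G: "(?G \<longlongrightarrow> ?G 0) (at 0 within {- d<..0})"
    using d(1) unfolding continuous_on_def by (elim ballE[of _ _ 0]) auto
  have D: "(?F has_real_derivative ?G h) (at h)" if "- d < h" "h < 0" for h
    by (rule has_real_derivative_line[OF u(2)[OF d(2)[OF that]]])
  have "((\<lambda>h. (?F h - ?F 0) / (h - 0)) \<longlongrightarrow> ?G 0) (at 0 within {..0})"
  proof (rule tendstoI)
    fix e :: real assume "e > 0"
    with G have "\<forall>\<^sub>F h in at 0 within {- d<..0}. dist (?G h) (?G 0) < e"
      by (rule tendstoD)
    then obtain r where r: "r > 0" "\<And>h. h \<in> {- d<..0} \<Longrightarrow> h \<noteq> 0 \<Longrightarrow> \<bar>h\<bar> < r \<Longrightarrow> dist (?G h) (?G 0) < e"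
      by (auto simp: eventually_at dist_real_def)
    show "\<forall>\<^sub>F h in at 0 within {..0}. dist ((?F h - ?F 0) / (h - 0)) (?G 0) < e"
      unfolding eventually_at
    proof (intro exI[of _ "min d r"] conjI ballI impI)
      fix h :: real assume h: "h \<in> {..0}" "h \<noteq> 0 \<and> dist h 0 < min d r"
      then have h': "h < 0" "- d < h" "- r < h" by (auto simp: dist_real_def)
      have "\<exists>z>h. z < 0 \<and> ?F 0 - ?F h = (0 - h) * ?G z"
      proof -
        have "continuous_on {h..0} ?F"
          by (rule continuous_on_subset[OF F]) (use h' in auto)
        moreover have "(?F has_derivative (\<lambda>x. x * ?G z)) (at z)" if "h < z" "z < 0" for z
          using D[of z] that h' by (simp add: has_field_derivative_def mult.commute[of _ "?G z"])
        ultimately obtain z where "h < z" "z < 0" "?F 0 - ?F h = (0 - h) * ?G z"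
          using mvt[of h 0 ?F "\<lambda>z x. x * ?G z"] h'(1) by auto
        then show ?thesis by blast
      qed
      then obtain z where z: "h < z" "z < 0" "?F 0 - ?F h = (0 - h) * ?G z" by blast
      have "(?F h - ?F 0) / (h - 0) = ?G z"
        using z(3) h' by (simp add: field_simps)
      then show "dist ((?F h - ?F 0) / (h - 0)) (?G 0) < e"
        using r(2)[of z] z h' by simp
    qed (use d r in simp)
  qed
  then have "(?F has_real_derivative ?G 0) (at 0 within {..0})"
    by (simp only: has_field_derivative_iff)
  then show ?thesis
    by (simp add: has_real_derivative_iff_has_vector_derivative)
qed

lemma at_within_atMost_neq_bot: "at (0::real) within {..0} \<noteq> bot"
proof -
  have "at_left (0::real) \<le> at 0 within {..0}"
    by (rule at_le) auto
  then show ?thesis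
    using trivial_limit_at_left_real[of 0] by (metis bot.extremum_uniqueI)
qed

lemma normal_deriv_eqI:
  assumes "((\<lambda>h. u (p + h *\<^sub>R outward_normal \<Omega> p)) has_vector_derivative D) (at 0 within {..0})"
  shows "normal_deriv \<Omega> u p = D"
  unfolding normal_deriv_def using at_within_atMost_neq_bot assms by (rule vector_derivative_within)

text \<open>Turns a pointwise estimate into one for normal derivatives: as both functions vanish at
  0, the inequality can be divided by the distance to the boundary point.\<close>

lemma one_sided_derivative_bound:
  fixes F G :: "real \<Rightarrow> real"
  assumes F: "(F has_vector_derivative D) (at 0 within {..0})" "F 0 = 0"
    and G: "(G has_vector_derivative D') (at 0 within {..0})" "G 0 = 0"
    and le: "\<And>h. - d < h \<Longrightarrow> h < 0 \<Longrightarrow> \<bar>F h\<bar> \<le> c * \<bar>G h\<bar>" and "d > 0"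
  shows "\<bar>D\<bar> \<le> c * \<bar>D'\<bar>"
proof (rule tendsto_le)
  show "at (0::real) within {..0} \<noteq> bot"
    by (rule at_within_atMost_neq_bot)
  have t: "((\<lambda>h. F h / h) \<longlongrightarrow> D) (at 0 within {..0})" "((\<lambda>h. G h / h) \<longlongrightarrow> D') (at 0 within {..0})"
    using F G by (simp_all add: has_real_derivative_iff_has_vector_derivative[symmetric] has_field_derivative_iff)
  show "((\<lambda>h. \<bar>F h / h\<bar>) \<longlongrightarrow> \<bar>D\<bar>) (at 0 within {..0})" "((\<lambda>h. c * \<bar>G h / h\<bar>) \<longlongrightarrow> c * \<bar>D'\<bar>) (at 0 within {..0})"
    by (rule tendsto_rabs[OF t(1)], rule tendsto_mult_left[OF tendsto_rabs[OF t(2)]])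
  show "\<forall>\<^sub>F h in at 0 within {..0}. \<bar>F h / h\<bar> \<le> c * \<bar>G h / h\<bar>"
    unfolding eventually_at
  proof (intro exI[of _ d] conjI ballI impI)
    fix h :: real assume "h \<in> {..0}" "h \<noteq> 0 \<and> dist h 0 < d"
    then have "- d < h" "h < 0" by (auto simp: dist_real_def)
    then show "\<bar>F h / h\<bar> \<le> c * \<bar>G h / h\<bar>"
      using le[of h] by (simp add: divide_right_mono_neg)
  qed fact
qed

section \<open>Barriers\<close>

lemma smooth_upto_closure_bounded:
  assumes "bounded \<Omega>" "smooth_upto_closure \<Omega> u"
  shows "\<exists>B. \<forall>x\<in>\<Omega>. \<bar>iter_partial is u x\<bar> \<le> B"
proof -
  obtain g where g: "continuous_on (closure \<Omega>) g" "\<forall>x\<in>\<Omega>. g x = iter_partial is u x"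
    using assms(2) unfolding smooth_upto_closure_def by blast
  have "compact (g ` closure \<Omega>)"
    using assms(1) g(1) by (intro compact_continuous_image) (auto simp: compact_closure)
  then obtain B where B: "\<And>y. y \<in> g ` closure \<Omega> \<Longrightarrow> norm y \<le> B"
    using compact_imp_bounded bounded_iff by metis
  have "\<bar>iter_partial is u x\<bar> \<le> B" if "x \<in> \<Omega>" for x
    using B[of "g x"] g(2) that closure_subset[of \<Omega>] by force
  then show ?thesis by blast
qed

lemma smooth_upto_closure_grad_extension:
  fixes u :: "real^'n::finite \<Rightarrow> real"
  assumes "smooth_upto_closure \<Omega> u"
  obtains g where "continuous_on (closure \<Omega>) g" "\<And>x. x \<in> \<Omega> \<Longrightarrow> g x = grad u x"
proof -
  have "\<forall>i. \<exists>g. continuous_on (closure \<Omega>) g \<and> (\<forall>x\<in>\<Omega>. g x = iter_partial [i] u x)"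
    using assms unfolding smooth_upto_closure_def by blast
  from choice[OF this] obtain g where g: "\<And>i. continuous_on (closure \<Omega>) (g i)"
      "\<And>i x. x \<in> \<Omega> \<Longrightarrow> g i x = iter_partial [i] u x"
    by blast
  show ?thesis
  proof (rule that[of "\<lambda>x. \<chi> i. g i x"])
    show "continuous_on (closure \<Omega>) (\<lambda>x. \<chi> i. g i x)"
      using g(1) by (rule continuous_on_vec_lambda)
    show "(\<chi> i. g i x) = grad u x" if "x \<in> \<Omega>" for x
      using g(2)[OF that] by (simp add: grad_def vec_eq_iff)
  qed
qed

lemma twice_differentiable_on_phi:
  fixes E :: "(real^'n::finite) set"
  assumes E: "subspace E"
  shows "twice_differentiable_on S (phi E) (orth_proj E) (\<lambda>_. matrix (orth_proj E))"
  unfolding twice_differentiable_on_def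
proof (intro ballI conjI allI)
  fix x i
  have bl: "bounded_linear (orth_proj E)"
    using linear_orth_proj[OF E] linear_conv_bounded_linear by blast
  have "phi E = (\<lambda>x. (orth_proj E x \<bullet> orth_proj E x) / 2)"
    by (simp add: phi_def fun_eq_iff power2_norm_eq_inner)
  moreover have "((\<lambda>x. (orth_proj E x \<bullet> orth_proj E x) / 2) has_derivative (\<lambda>h. orth_proj E x \<bullet> h)) (at x)"
  proof (rule has_derivative_eq_rhs)
    show "((\<lambda>x. (orth_proj E x \<bullet> orth_proj E x) / 2) has_derivative
        (\<lambda>h. (orth_proj E x \<bullet> orth_proj E h + orth_proj E h \<bullet> orth_proj E x) / 2)) (at x)"
      by (intro bounded_linear.has_derivative[OF bounded_linear_divide] has_derivative_inner
          bounded_linear_imp_has_derivative bl)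
    show "(\<lambda>h. (orth_proj E x \<bullet> orth_proj E h + orth_proj E h \<bullet> orth_proj E x) / 2) = (\<lambda>h. orth_proj E x \<bullet> h)"
      by (simp add: fun_eq_iff inner_commute[of _ "orth_proj E x"] orth_proj_inner[OF E, of x, symmetric])
  qed
  ultimately show "(phi E has_derivative (\<lambda>h. orth_proj E x \<bullet> h)) (at x)"
    by simp
  have "(\<lambda>y. orth_proj E y $ i) = (\<lambda>h. matrix (orth_proj E) $ i \<bullet> h)"
    by (simp add: fun_eq_iff matrix_vector_mul_component[symmetric] matrix_orth_proj_mult[OF E])
  then show "((\<lambda>y. orth_proj E y $ i) has_derivative (\<lambda>h. matrix (orth_proj E) $ i \<bullet> h)) (at x)"
    by (simp only:) (rule bounded_linear_imp_has_derivative[OF bounded_linear_inner_right])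
qed

lemma poisson_correction_trace:
  assumes "subspace E" "poisson_correction \<Omega> E f w" "x \<in> \<Omega>"
  shows "trace (matrix (orth_proj (E\<^sup>\<bottom>)) ** hessian w x) = f x"
proof -
  \<comment> \<open>The section through \<open>x\<close> is the one over its own projection to
    \<open>E\<close>.\<close>
  have "x \<in> (+) (orth_proj E x) ` (E\<^sup>\<bottom>)"
    using orth_proj_in(2)[OF assms(1), of x] by (intro image_eqI[of _ _ "x - orth_proj E x"]) auto
  then show ?thesis
    using assms(2,3) unfolding poisson_correction_def Let_def sub_laplacian_def by blast
qed

text \<open>The error is kept proportional to \<open>\<bar>w x\<bar>\<close>, and not just to its
  supremum, because the factor vanishing on the boundary is what survives in the normal derivative.
  \<open>C / t ^ k\<close> is the relative error of the correction term.\<close>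

lemma k_hessian_barrier_estimate:
  fixes \<Omega> E :: "(real^'n::finite) set" and u :: "real \<Rightarrow> real^'n \<Rightarrow> real"
  assumes k: "1 \<le> k" and \<Omega>: "bounded \<Omega>" "open \<Omega>"
    and E: "subspace E" "dim E = k - 1"
    and f: "c\<^sub>0 > 0" "\<And>x. x \<in> \<Omega> \<Longrightarrow> f x \<ge> c\<^sub>0"
    and u: "\<And>t. t > 0 \<Longrightarrow> k_hessian_solution k \<Omega> f (\<lambda>x. t * phi E x) (u t)"
    and w: "poisson_correction \<Omega> E f w"
  shows "\<exists>C\<ge>0. \<exists>T\<ge>1. \<forall>t\<ge>T. \<forall>x\<in>\<Omega>. \<bar>u t x - t * phi E x - t / t ^ k * w x\<bar> \<le> C / t ^ k * (t / t ^ k) * \<bar>w x\<bar>"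
proof -
  let ?P = "matrix (orth_proj E)" and ?H = "hessian w"
  have ws: "smooth_upto_closure \<Omega> w" and w0: "\<And>x. x \<in> frontier \<Omega> \<Longrightarrow> w x = 0"
    using w by (auto simp: poisson_correction_def)
  then have wsm: "smooth_on \<Omega> w" and wc: "continuous_on (closure \<Omega>) w"
    by (auto simp: smooth_upto_closure_def)
  have Ht: "transpose (?H x) = ?H x" if "x \<in> \<Omega>" for x
    using transpose_hessian[OF \<Omega>(2) wsm that] .
  have "\<exists>B. \<forall>x\<in>\<Omega>. \<bar>?H x $ i $ j\<bar> \<le> B" for i j
    using smooth_upto_closure_bounded[OF \<Omega>(1) ws, of "[i, j]"] by (auto simp: hessian_def)
  then obtain b where b: "\<forall>x\<in>\<Omega>. \<bar>?H x $ i $ j\<bar> \<le> b i j" for i j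
    by metis
  define B where "B = (\<Sum>i\<in>UNIV. \<Sum>j\<in>UNIV. \<bar>b i j\<bar>)"
  have B0: "0 \<le> B" by (simp add: B_def sum_nonneg)
  have HB: "\<bar>?H x $ i $ j\<bar> \<le> B" if "x \<in> \<Omega>" for x i j
  proof -
    have "\<bar>?H x $ i $ j\<bar> \<le> \<bar>b i j\<bar>" using b[of i j] that by fastforce
    also have "\<dots> \<le> (\<Sum>j\<in>UNIV. \<bar>b i j\<bar>)"
      by (rule member_le_sum) auto
    also have "\<dots> \<le> B"
      unfolding B_def by (rule member_le_sum[of i UNIV "\<lambda>i. \<Sum>j\<in>UNIV. \<bar>b i j\<bar>"]) (auto intro: sum_nonneg)
    finally show ?thesis .
  qed
  have dimE: "dim E + 1 = k" using E(2) k by simp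
  \<comment> \<open>The factor 2 in \<open>2 * B\<close> leaves room for the multiples
    \<open>s = 1 \<plusminus> \<epsilon>\<close> of the Hessian of \<open>w\<close>, which satisfy
    \<open>0 \<le> s \<le> 2\<close>.\<close>
  obtain C where C: "C \<ge> 0" and expansion: "\<forall>\<delta>\<in>{0..1}. \<forall>M. transpose M = M \<and> (\<forall>i j. \<bar>M $ i $ j\<bar> \<le> 2 * B) \<longrightarrow>
    \<bar>sigma k (?P + \<delta> *\<^sub>R M) - \<delta> * trace (matrix (orth_proj (E\<^sup>\<bottom>)) ** M)\<bar> \<le> C * \<delta>\<^sup>2"
    using sigma_near_projection[OF E(1) dimE, of "2 * B"] by (elim exE conjE)
  have "\<forall>j. \<exists>C. j \<in> {1..dim E} \<longrightarrow> (\<forall>\<delta>\<in>{0..1}. \<forall>M. transpose M = M \<and> (\<forall>i j. \<bar>M $ i $ j\<bar> \<le> 2 * B) \<longrightarrow>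
      sigma j (?P + \<delta> *\<^sub>R M) \<ge> 1 - C * \<delta>)"
    using sigma_near_projection_lower[OF E(1), of _ "2 * B"] B0 by simp
  from choice[OF this] obtain D where lower: "\<And>j. j \<in> {1..dim E} \<Longrightarrow>
      \<forall>\<delta>\<in>{0..1}. \<forall>M. transpose M = M \<and> (\<forall>i j. \<bar>M $ i $ j\<bar> \<le> 2 * B) \<longrightarrow> sigma j (?P + \<delta> *\<^sub>R M) \<ge> 1 - D j * \<delta>"
    by blast
  \<comment> \<open>Chosen so that \<open>\<epsilon> * c\<^sub>0 = (C + 1) * \<delta>\<close>,
    strictly more than the expansion error \<open>C * \<delta>\<close>.\<close>
  define A where "A = (C + 1) / c\<^sub>0"
  have A: "0 < A" using C f(1) by (simp add: A_def)
  \<comment> \<open>For \<open>t \<ge> T\<close> one has \<open>t * \<delta> \<le> 1\<close>. Then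
    \<open>t \<ge> A\<close> gives \<open>\<epsilon> \<le> 1\<close>, and
    \<open>t > \<bar>D j\<bar>\<close> gives \<open>D j * \<delta> < 1\<close>, so the lower
    \<open>sigma j\<close> of the lower barrier are positive.\<close>
  define T where "T = 1 + A + (\<Sum>j\<in>{1..dim E}. \<bar>D j\<bar>)"
  have T: "1 + A \<le> T" "1 \<le> T" using A by (simp_all add: T_def sum_nonneg add_nonneg_nonneg)
  have DT: "\<bar>D j\<bar> < T" if "j \<in> {1..dim E}" for j
    using member_le_sum[OF that, of "\<lambda>j. \<bar>D j\<bar>"] A by (simp add: T_def)
  have "\<bar>u t x - t * phi E x - t / t ^ k * w x\<bar> \<le> A / t ^ k * (t / t ^ k) * \<bar>w x\<bar>"
    if t: "T \<le> t" and x: "x \<in> \<Omega>" for t x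
  proof -
    have t1: "1 \<le> t" "0 < t" using t T by auto
    define \<delta> where "\<delta> = 1 / t ^ k"
    have \<delta>t: "t ^ k * \<delta> = 1" and \<delta>0: "0 < \<delta>" using t1 by (simp_all add: \<delta>_def)
    have "t ^ 1 \<le> t ^ k" using k t1 by (intro power_increasing) auto
    then have t\<delta>: "t * \<delta> \<le> 1" using t1 by (simp add: \<delta>_def)
    have "1 * \<delta> \<le> t * \<delta>" using t1 \<delta>0 by (intro mult_right_mono) auto
    then have "\<delta> \<le> 1" using t\<delta> by linarith
    then have \<delta>: "\<delta> \<in> {0..1}" using \<delta>0 by simp
    define \<epsilon> where "\<epsilon> = A * \<delta>"
    have "A * \<delta> \<le> t * \<delta>" using t T(1) \<delta>0 by (intro mult_right_mono) auto
    then have "\<epsilon> \<le> 1" using t\<delta> unfolding \<epsilon>_def by linarith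
    moreover have "0 < \<epsilon>" using A \<delta>0 by (simp add: \<epsilon>_def)
    ultimately have \<epsilon>: "0 < \<epsilon>" "\<epsilon> \<le> 1" by simp_all
    let ?c = "t * \<delta>"
    let ?b = "\<lambda>s x. t * phi E x + (?c * s) * w x"
    let ?Hb = "\<lambda>s x. t *\<^sub>R ?P + (?c * s) *\<^sub>R ?H x"
    have twice: "twice_differentiable_on \<Omega> (?b s) (\<lambda>x. t *\<^sub>R orth_proj E x + (?c * s) *\<^sub>R grad w x) (?Hb s)" for s
      by (intro twice_differentiable_on_add twice_differentiable_on_cmult twice_differentiable_on_phi[OF E(1)]
          twice_differentiable_on_smooth[OF \<Omega>(2) wsm])
    have sym: "transpose (?Hb s x) = ?Hb s x" if "x \<in> \<Omega>" for s x
      using Ht[OF that] transpose_orth_proj[OF E(1)] by (simp add: transpose_def vec_eq_iff)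
    have M: "transpose (s *\<^sub>R ?H x) = s *\<^sub>R ?H x \<and> (\<forall>i j. \<bar>(s *\<^sub>R ?H x) $ i $ j\<bar> \<le> 2 * B)"
      if "0 \<le> s" "s \<le> 2" "x \<in> \<Omega>" for s x
      using Ht[OF that(3)] HB[OF that(3)] that by (simp add: transpose_def vec_eq_iff abs_mult mult_mono)
    have scale: "sigma j (?Hb s x) = t ^ j * sigma j (?P + \<delta> *\<^sub>R (s *\<^sub>R ?H x))" if "x \<in> \<Omega>" for j s x
    proof -
      have "?Hb s x = t *\<^sub>R (?P + \<delta> *\<^sub>R (s *\<^sub>R ?H x))"
        by (simp add: scaleR_right_distrib)
      moreover have "transpose (?P + \<delta> *\<^sub>R (s *\<^sub>R ?H x)) = ?P + \<delta> *\<^sub>R (s *\<^sub>R ?H x)"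
        using Ht[OF that] transpose_orth_proj[OF E(1)] by (simp add: transpose_def vec_eq_iff)
      ultimately show ?thesis by (simp only: sigma_scaleR)
    qed
    \<comment> \<open>Homogeneity contributes \<open>t ^ k\<close>, the reciprocal of \<delta>: the
      linear term becomes exactly \<open>s * f x\<close> by the Poisson equation on the sections,
      and the quadratic error becomes linear in \<delta>.\<close>
    have sk: "\<bar>sigma k (?Hb s x) - s * f x\<bar> \<le> C * \<delta>" if "0 \<le> s" "s \<le> 2" "x \<in> \<Omega>" for s x
    proof -
      have "trace (matrix (orth_proj (E\<^sup>\<bottom>)) ** (s *\<^sub>R ?H x)) = s * f x"
        using poisson_correction_trace[OF E(1) w that(3)]
        by (simp add: matrix_algebra_simps trace_def sum_distrib_left[symmetric])
      then have *: "\<bar>sigma k (?P + \<delta> *\<^sub>R (s *\<^sub>R ?H x)) - \<delta> * (s * f x)\<bar> \<le> C * \<delta>\<^sup>2"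
        using expansion[rule_format, OF \<delta> M[OF that]] by simp
      have "sigma k (?Hb s x) - s * f x = t ^ k * (sigma k (?P + \<delta> *\<^sub>R (s *\<^sub>R ?H x)) - \<delta> * (s * f x))"
      proof -
        have "t ^ k * (\<delta> * (s * f x)) = s * f x" using \<delta>t by (simp add: mult.assoc[symmetric])
        then show ?thesis unfolding scale[OF that(3)] by (simp only: right_diff_distrib)
      qed
      also have "\<bar>\<dots>\<bar> \<le> t ^ k * (C * \<delta>\<^sup>2)"
        unfolding abs_mult using * t1 by (intro mult_mono) auto
      also have "\<dots> = C * \<delta> * (t ^ k * \<delta>)" by (simp add: power2_eq_square)
      finally show ?thesis using \<delta>t by simp
    qed
    have margin: "C * \<delta> < \<epsilon> * f x" if "x \<in> \<Omega>" for x
    proof -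
      have "C * \<delta> < (C + 1) * \<delta>" using \<delta>0 by simp
      also have "\<dots> = \<epsilon> * c\<^sub>0" using f(1) by (simp add: \<epsilon>_def A_def)
      also have "\<dots> \<le> \<epsilon> * f x" using \<epsilon> f(2)[OF that] by (intro mult_left_mono) auto
      finally show ?thesis .
    qed
    have sol: "smooth_upto_closure \<Omega> (u t)" "admissible k \<Omega> (u t)" "\<And>x. x \<in> \<Omega> \<Longrightarrow> sigma k (hessian (u t) x) = f x"
      "\<And>x. x \<in> frontier \<Omega> \<Longrightarrow> u t x = t * phi E x"
      using u[OF t1(2)] by (auto simp: k_hessian_solution_def)
    then have us: "smooth_on \<Omega> (u t)" and uc: "continuous_on (closure \<Omega>) (u t)"
      by (auto simp: smooth_upto_closure_def)
    have "continuous_on (closure \<Omega>) (phi E)"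
      using twice_differentiable_on_phi[OF E(1), of UNIV] unfolding twice_differentiable_on_def
      by (meson UNIV_I continuous_at_imp_continuous_on has_derivative_continuous)
    then have bc: "continuous_on (closure \<Omega>) (?b s)" for s
      using wc by (intro continuous_intros)
    \<comment> \<open>The lower barrier takes the role of \<open>a\<close>, so its positivity must
      be shown: degree \<open>k\<close> follows from the strict inequality and \<open>f > 0\<close>,
      the lower degrees from closeness to the projection.\<close>
    have lo: "?b (1 + \<epsilon>) x \<le> u t x"
    proof (rule k_hessian_comparison[OF \<Omega>(2,1) k twice bc twice_differentiable_on_smooth[OF \<Omega>(2) us] uc])
      fix x assume x: "x \<in> \<Omega>"
      show less: "sigma k (hessian (u t) x) < sigma k (?Hb (1 + \<epsilon>) x)"
        using sk[of "1 + \<epsilon>", OF _ _ x] margin[OF x] \<epsilon> by (simp add: sol(3)[OF x] algebra_simps)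
      fix j assume j: "j \<in> {1..k}"
      show "0 < sigma j (?Hb (1 + \<epsilon>) x)"
      proof (cases "j = k")
        case True
        then show ?thesis using less sol(3)[OF x] f(2)[OF x] f(1) by simp
      next
        case False
        then have j: "j \<in> {1..dim E}" using j E(2) by auto
        have "D j * \<delta> < t * \<delta>"
          using DT[OF j] t \<delta>0 by (intro mult_strict_right_mono) auto
        then have "0 < sigma j (?P + \<delta> *\<^sub>R ((1 + \<epsilon>) *\<^sub>R ?H x))"
          using lower[OF j, rule_format, OF \<delta> M[of "1 + \<epsilon>", OF _ _ x]] \<epsilon> t\<delta> by auto
        then show ?thesis unfolding scale[OF x] using t1 by simp
      qed
    qed (use sym x transpose_hessian[OF \<Omega>(2) us] sol(4) w0 in auto)
    \<comment> \<open>Here the solution takes the role of \<open>a\<close>, and its admissibility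
      provides the positivity.\<close>
    have hi: "u t x \<le> ?b (1 - \<epsilon>) x"
    proof (rule k_hessian_comparison[OF \<Omega>(2,1) k twice_differentiable_on_smooth[OF \<Omega>(2) us] uc twice bc])
      fix x assume x: "x \<in> \<Omega>"
      show "sigma k (?Hb (1 - \<epsilon>) x) < sigma k (hessian (u t) x)"
        using sk[of "1 - \<epsilon>", OF _ _ x] margin[OF x] \<epsilon> by (simp add: sol(3)[OF x] algebra_simps)
      show "0 < sigma j (hessian (u t) x)" if "j \<in> {1..k}" for j
        using sol(2) x that unfolding admissible_def Gamma_cone_def sigma_def by blast
    qed (use sym x transpose_hessian[OF \<Omega>(2) us] sol(4) w0 in auto)
    \<comment> \<open>The two inequalities place the difference between
      \<open>\<epsilon> * ?c * w x\<close> and its negative.\<close>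
    have "\<bar>u t x - t * phi E x - ?c * w x\<bar> \<le> \<bar>\<epsilon> * ?c * w x\<bar>"
      using lo hi by (simp add: algebra_simps)
    also have "\<dots> = \<epsilon> * ?c * \<bar>w x\<bar>"
      using \<epsilon> t1 \<delta>0 by (simp add: abs_mult)
    finally show ?thesis by (simp add: \<delta>_def \<epsilon>_def)
  qed
  then show ?thesis
    using A T by (intro exI[of _ A] conjI exI[of _ T]) auto
qed

theorem proposition4p5:
  fixes \<Omega> E K :: "(real^'n::finite) set"
    and k :: nat
    and c\<^sub>0 :: real
    and f w :: "real^'n \<Rightarrow> real"
    and u :: "real \<Rightarrow> real^'n \<Rightarrow> real"
  assumes "2 \<le> k" and "k \<le> CARD('n)"
    and "bounded \<Omega>" and "smooth_domain \<Omega>" and "uniformly_convex \<Omega>"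
    and "subspace E" and "dim E = k - 1"
    and "smooth_upto_closure \<Omega> f" and "c\<^sub>0 > 0" and "\<And>x. x \<in> closure \<Omega> \<Longrightarrow> f x \<ge> c\<^sub>0"
    and "\<And>t. t > 0 \<Longrightarrow> k_hessian_solution k \<Omega> f (\<lambda>x. t * phi E x) (u t)"
    and "poisson_correction \<Omega> E f w"
    and "compact K" and "K \<subseteq> transversal_boundary \<Omega> E"
  shows "\<exists>C. \<forall>\<^sub>F t in at_top. \<forall>x\<in>K.
    \<bar>normal_deriv \<Omega> (u t) x
       - (t * normal_deriv \<Omega> (phi E) x + t powr (1 - real k) * normal_deriv \<Omega> w x)\<bar>
    \<le> C * t powr (1 - real k - real k / 2)"
proof -
  have op: "open \<Omega>" using assms(4) by (simp add: smooth_domain_def)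
  have k: "1 \<le> k" using assms(1) by simp
  have f: "\<And>x. x \<in> \<Omega> \<Longrightarrow> f x \<ge> c\<^sub>0"
    using assms(10) closure_subset by blast
  obtain C T where C: "C \<ge> 0" and T: "T \<ge> 1" and est: "\<And>t x. T \<le> t \<Longrightarrow> x \<in> \<Omega> \<Longrightarrow>
      \<bar>u t x - t * phi E x - t / t ^ k * w x\<bar> \<le> C / t ^ k * (t / t ^ k) * \<bar>w x\<bar>"
    using k_hessian_barrier_estimate[OF k assms(3) op assms(6,7,9) f assms(11,12)] by blast
  have ws: "smooth_upto_closure \<Omega> w" and w0: "\<And>x. x \<in> frontier \<Omega> \<Longrightarrow> w x = 0"
    using assms(12) by (auto simp: poisson_correction_def)
  obtain g where g: "continuous_on (closure \<Omega>) g" "\<And>x. x \<in> \<Omega> \<Longrightarrow> g x = grad w x"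
    using smooth_upto_closure_grad_extension[OF ws] by blast
  \<comment> \<open>Compactness bounds the extended gradient of \<open>w\<close> on all of the
    closure, which makes the final constant independent of the boundary point.\<close>
  have "compact (g ` closure \<Omega>)"
    using assms(3) g(1) by (intro compact_continuous_image) (auto simp: compact_closure)
  then obtain B where B: "\<And>x. x \<in> closure \<Omega> \<Longrightarrow> norm (g x) \<le> B"
    using compact_imp_bounded bounded_iff by (metis imageI)
  have smooth: "((\<lambda>h. v (p + h *\<^sub>R outward_normal \<Omega> p)) has_vector_derivative (gv p \<bullet> outward_normal \<Omega> p)) (at 0 within {..0})"
    if v: "smooth_upto_closure \<Omega> v" and gv: "continuous_on (closure \<Omega>) gv" "\<And>x. x \<in> \<Omega> \<Longrightarrow> gv x = grad v x"
      and p: "p \<in> frontier \<Omega>" for v gv p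
  proof (rule has_vector_derivative_inward_ray[OF assms(4) p _ _ gv(1)])
    show "continuous_on (closure \<Omega>) v"
      using v by (simp add: smooth_upto_closure_def)
    fix x assume x: "x \<in> \<Omega>"
    have "smooth_on \<Omega> v"
      using v by (simp add: smooth_upto_closure_def)
    from has_derivative_grad[OF smooth_on_differentiable[OF op this x, of "[]", simplified]]
    show "(v has_derivative (\<lambda>h. gv x \<bullet> h)) (at x)"
      by (simp only: gv(2)[OF x])
  qed
  have main: "\<bar>normal_deriv \<Omega> (u t) p
       - (t * normal_deriv \<Omega> (phi E) p + t powr (1 - real k) * normal_deriv \<Omega> w p)\<bar>
    \<le> C * \<bar>B\<bar> * t powr (1 - real k - real k / 2)" if t: "T \<le> t" and p: "p \<in> frontier \<Omega>" for t p
  proof -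
    have t1: "1 \<le> t" "0 < t" using t T by auto
    have us: "smooth_upto_closure \<Omega> (u t)" and ub: "u t p = t * phi E p"
      using assms(11)[OF t1(2)] p by (auto simp: k_hessian_solution_def)
    let ?\<nu> = "outward_normal \<Omega> p" and ?c = "t / t ^ k"
    obtain gu where gu: "continuous_on (closure \<Omega>) gu" "\<And>x. x \<in> \<Omega> \<Longrightarrow> gu x = grad (u t) x"
      using smooth_upto_closure_grad_extension[OF us] by blast
    note Du = smooth[OF us gu p] and Dw = smooth[OF ws g p]
    have D\<phi>: "((\<lambda>h. phi E (p + h *\<^sub>R ?\<nu>)) has_vector_derivative (orth_proj E p \<bullet> ?\<nu>)) (at 0 within {..0})"
    proof -
      have "(phi E has_derivative (\<lambda>h. orth_proj E p \<bullet> h)) (at (p + 0 *\<^sub>R ?\<nu>))"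
        using twice_differentiable_on_phi[OF assms(6), of UNIV] unfolding twice_differentiable_on_def by simp
      from has_real_derivative_line[OF this] show ?thesis
        by (simp only: has_real_derivative_iff_has_vector_derivative has_vector_derivative_at_within)
    qed
    let ?D = "gu p \<bullet> ?\<nu> - t * (orth_proj E p \<bullet> ?\<nu>) - ?c * (g p \<bullet> ?\<nu>)"
    obtain d where d: "d > 0" "\<And>h. - d < h \<Longrightarrow> h < 0 \<Longrightarrow> p + h *\<^sub>R ?\<nu> \<in> \<Omega>"
      using outward_normal_inward_ray(2)[OF assms(4) p] by blast
    \<comment> \<open>At \<open>p\<close> the error vanishes together with \<open>w\<close>, because
      \<open>u t\<close> and \<open>t * phi E\<close> share their boundary values.\<close>
    have "\<bar>?D\<bar> \<le> C / t ^ k * ?c * \<bar>g p \<bullet> ?\<nu>\<bar>"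
    proof (rule one_sided_derivative_bound[OF _ _ Dw])
      show "((\<lambda>h. u t (p + h *\<^sub>R ?\<nu>) - t * phi E (p + h *\<^sub>R ?\<nu>) - ?c * w (p + h *\<^sub>R ?\<nu>)) has_vector_derivative ?D) (at 0 within {..0})"
        by (intro has_vector_derivative_diff has_vector_derivative_mult_right Du Dw D\<phi>)
      show "\<bar>u t (p + h *\<^sub>R ?\<nu>) - t * phi E (p + h *\<^sub>R ?\<nu>) - ?c * w (p + h *\<^sub>R ?\<nu>)\<bar>
          \<le> C / t ^ k * ?c * \<bar>w (p + h *\<^sub>R ?\<nu>)\<bar>" if "- d < h" "h < 0" for h
        by (rule est[OF t d(2)[OF that]])
    qed (use w0[OF p] ub d(1) in auto)
    also have "\<dots> \<le> C / t ^ k * ?c * \<bar>B\<bar>"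
    proof (rule mult_left_mono)
      have "\<bar>g p \<bullet> ?\<nu>\<bar> \<le> norm (g p) * norm ?\<nu>"
        by (rule Cauchy_Schwarz_ineq2)
      also have "\<dots> \<le> B"
        using B[of p] p outward_normal_inward_ray(1)[OF assms(4) p] by (simp add: frontier_def)
      finally show "\<bar>g p \<bullet> ?\<nu>\<bar> \<le> \<bar>B\<bar>" by simp
    qed (use C t1 in simp)
    \<comment> \<open>The relative error \<open>t ^ (- k)\<close> multiplies the correction of size
      \<open>t ^ (1 - k)\<close>; the claimed exponent is larger and
      \<open>t \<ge> 1\<close>.\<close>
    also have "\<dots> = C * \<bar>B\<bar> * t powr (1 - real k - real k)"
      unfolding powr_diff using t1 by (simp add: powr_realpow)
    also have "\<dots> \<le> C * \<bar>B\<bar> * t powr (1 - real k - real k / 2)"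
      using C t1 by (intro mult_left_mono powr_mono) auto
    finally have "\<bar>?D\<bar> \<le> C * \<bar>B\<bar> * t powr (1 - real k - real k / 2)" .
    moreover have "t powr (1 - real k) = ?c"
      using t1 by (simp add: powr_diff powr_realpow)
    ultimately show ?thesis
      by (simp only: normal_deriv_eqI[OF Du] normal_deriv_eqI[OF Dw] normal_deriv_eqI[OF D\<phi>] diff_diff_eq)
  qed
  show ?thesis
    using assms(14) main unfolding transversal_boundary_def
    by (intro exI[of _ "C * \<bar>B\<bar>"] eventually_at_top_linorderI[of T]) blast
qed

end
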